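(* Suppose that $X$ is a Lévy process with $X_0=0$ which is not a compound Poisson process and drifts to $-\infty$. Suppose that $\mathbb{E}[\theta]=\infty$. Then the problem $\inf_\tau\mathbb{E}[|\theta-\tau|]$ is degenerate, i.e. for all stopping times $\tau$ it holds that $\mathbb{E}[|\theta-\tau|]=\infty$.
   Context: $X=(X_t)_{t\ge0}$ is a real-valued Lévy process starting from $0$ on a filtered probability space $(\Omega,\mathcal{F},\mathbf{F},\mathbb{P})$, where $\mathbf{F}$ is the naturally enlarged filtration generated by $X$; stopping times are with respect to $\mathbf{F}$. "$X$ drifts to $-\infty$" means $\lim_{t\to\infty}X_t=-\infty$ a.s. A compound Poisson process is understood without drift. Write $\overline{X}_t=\sup_{0\le s\le t}X_s$, $\overline{X}_\infty=\lim_{t\to\infty}\overline{X}_t$, and $\theta=\inf\{t\ge0\mid\overline{X}_t=\overline{X}_\infty\}$ (with $\inf\emptyset=\infty$). *)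

theory Defs
  imports "HOL-Probability.Probability"
begin

definition cadlag :: "(real \<Rightarrow> real) \<Rightarrow> bool" where
  "cadlag f \<longleftrightarrow> (\<forall>t\<ge>0. (f \<longlongrightarrow> f t) (at_right t)) \<and> (\<forall>t>0. \<exists>l. (f \<longlongrightarrow> l) (at_left t))"

text \<open>
  Processes have type \<open>real \<Rightarrow> 'a \<Rightarrow> _\<close>; only their values at nonnegative times matter.
\<close>

locale levy_process = prob_space M for M :: "'a measure" +
  fixes X :: "real \<Rightarrow> 'a \<Rightarrow> real"
  assumes random_variable_X: "\<And>t. 0 \<le> t \<Longrightarrow> X t \<in> borel_measurable M"
    and start_zero: "AE \<omega> in M. X 0 \<omega> = 0"
    and indep_increments:
      "\<And>(t :: nat \<Rightarrow> real) n. mono t \<Longrightarrow> 0 \<le> t 0 \<Longrightarrow>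
         indep_vars (\<lambda>_. borel) (\<lambda>i \<omega>. X (t (Suc i)) \<omega> - X (t i) \<omega>) {..<n}"
    and stationary_increments:
      "\<And>s t. 0 \<le> s \<Longrightarrow> 0 \<le> t \<Longrightarrow>
         distr M borel (\<lambda>\<omega>. X (s + t) \<omega> - X s \<omega>) = distr M borel (X t)"
    and cadlag_paths: "AE \<omega> in M. cadlag (\<lambda>t. X t \<omega>)"

definition poisson_process :: "'a measure \<Rightarrow> real \<Rightarrow> (real \<Rightarrow> 'a \<Rightarrow> nat) \<Rightarrow> bool" where
  "poisson_process M r N \<longleftrightarrow>
     levy_process M (\<lambda>t \<omega>. real (N t \<omega>)) \<and>
     (\<forall>t\<ge>0. \<forall>k. measure M {\<omega> \<in> space M. N t \<omega> = k} = exp (- (r * t)) * (r * t) ^ k / fact k)"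

text \<open>
  A compound Poisson process (without drift) is \<open>X t = \<xi> 0 + \<dots> + \<xi> (N t - 1)\<close> for a Poisson
  process \<open>N\<close> of positive rate and i.i.d. jumps \<open>\<xi>\<close> that are independent of \<open>N\<close>. Asking for
  \<open>N\<close> and \<open>\<xi>\<close> on the given space is no restriction unless the jumps vanish almost surely:
  both can be read off the paths of \<open>X\<close>.
\<close>

definition compound_poisson_process :: "'a measure \<Rightarrow> (real \<Rightarrow> 'a \<Rightarrow> real) \<Rightarrow> bool" where
  "compound_poisson_process M X \<longleftrightarrow>
     (\<exists>r > 0. \<exists>(N :: real \<Rightarrow> 'a \<Rightarrow> nat) (\<xi> :: nat \<Rightarrow> 'a \<Rightarrow> real).
        poisson_process M r N \<and>
        prob_space.indep_vars M (\<lambda>_. borel) \<xi> UNIV \<and>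
        (\<forall>i. distr M borel (\<xi> i) = distr M borel (\<xi> 0)) \<and>
        prob_space.indep_var M
          (Pi\<^sub>M {0..} (\<lambda>_. count_space UNIV)) (\<lambda>\<omega>. \<lambda>t\<in>{0..}. N t \<omega>)
          (Pi\<^sub>M UNIV (\<lambda>_. borel)) (\<lambda>\<omega> i. \<xi> i \<omega>) \<and>
        (AE \<omega> in M. \<forall>t\<ge>0. X t \<omega> = (\<Sum>i<N t \<omega>. \<xi> i \<omega>)))"

definition drifts_to_minus_infinity :: "'a measure \<Rightarrow> (real \<Rightarrow> 'a \<Rightarrow> real) \<Rightarrow> bool" where
  "drifts_to_minus_infinity M X \<longleftrightarrow> (AE \<omega> in M. filterlim (\<lambda>t. X t \<omega>) at_bot at_top)"

text \<open>
  The filtration is indexed by \<open>[0, \<infinity>]\<close> so that stopping times may take the value \<open>\<infinity>\<close>.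
  The null sets are those of the completion of \<open>M\<close>, so \<open>M\<close> itself need not be complete.
\<close>

definition completed_filtration ::
    "'a measure \<Rightarrow> (real \<Rightarrow> 'a \<Rightarrow> real) \<Rightarrow> ennreal \<Rightarrow> 'a measure" where
  "completed_filtration M X t = sigma (space M)
     ({X s -` B \<inter> space M | s B. 0 \<le> s \<and> ennreal s \<le> t \<and> B \<in> sets borel} \<union>
      null_sets (completion M))"

text \<open>
  The enlarged filtration is the right-continuous version of the completed one. The
  disjunct \<open>s = \<infinity>\<close> only matters for \<open>t = \<infinity>\<close>, where no \<open>s > t\<close> exists.
\<close>

definition enlarged_filtration ::
    "'a measure \<Rightarrow> (real \<Rightarrow> 'a \<Rightarrow> real) \<Rightarrow> ennreal \<Rightarrow> 'a measure" where
  "enlarged_filtration M X t = sigma (space M)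
     (\<Inter>s\<in>{s. t < s \<or> s = \<infinity>}. sets (completed_filtration M X s))"

lemma completed_filtration_gen_subset:
  "{X s -` B \<inter> space M | s B. 0 \<le> s \<and> ennreal s \<le> t \<and> B \<in> sets borel} \<union>
     null_sets (completion M) \<subseteq> Pow (space M)"
  using sets.sets_into_space[of _ "completion M"] by (auto simp: null_sets_def)

lemma space_completed_filtration [simp]: "space (completed_filtration M X t) = space M"
  unfolding completed_filtration_def by (rule space_measure_of[OF completed_filtration_gen_subset])

lemma enlarged_filtration_gen_subset:
  "(\<Inter>s\<in>{s. t < s \<or> s = \<infinity>}. sets (completed_filtration M X s)) \<subseteq> Pow (space M)"
  using sets.space_closed[of "completed_filtration M X \<infinity>"] by auto

lemma space_enlarged_filtration [simp]: "space (enlarged_filtration M X t) = space M"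
  unfolding enlarged_filtration_def by (rule space_measure_of[OF enlarged_filtration_gen_subset])

lemma sets_enlarged_filtration:
  "sets (enlarged_filtration M X t) =
     (\<Inter>s\<in>{s. t < s \<or> s = \<infinity>}. sets (completed_filtration M X s))"
proof -
  let ?A = "\<Inter>s\<in>{s. t < s \<or> s = \<infinity>}. sets (completed_filtration M X s)"
  have sa: "sigma_algebra (space M) (sets (completed_filtration M X s))" for s
    using sets.sigma_algebra_axioms[of "completed_filtration M X s"] by simp
  have "sigma_sets (space M) ?A \<subseteq> sets (completed_filtration M X s)"
    if "t < s \<or> s = \<infinity>" for s
    by (rule sigma_algebra.sigma_sets_subset[OF sa]) (use that in blast)
  hence "sigma_sets (space M) ?A = ?A"
    by (intro equalityI INT_greatest) (auto intro: sigma_sets.Basic)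
  thus ?thesis
    unfolding enlarged_filtration_def
    using sets_measure_of[OF enlarged_filtration_gen_subset] by metis
qed

lemma filtration_enlarged_filtration: "filtration (space M) (enlarged_filtration M X)"
proof
  fix i j :: ennreal assume "i \<le> j"
  thus "sets (enlarged_filtration M X i) \<subseteq> sets (enlarged_filtration M X j)"
    unfolding sets_enlarged_filtration by (intro INF_superset_mono) auto
qed simp

definition running_sup :: "(real \<Rightarrow> 'a \<Rightarrow> real) \<Rightarrow> real \<Rightarrow> 'a \<Rightarrow> ereal" where
  "running_sup X t \<omega> = (SUP s\<in>{0..t}. ereal (X s \<omega>))"

definition ultimate_sup :: "(real \<Rightarrow> 'a \<Rightarrow> real) \<Rightarrow> 'a \<Rightarrow> ereal" where
  "ultimate_sup X \<omega> = Lim at_top (\<lambda>t. running_sup X t \<omega>)"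

definition time_of_sup :: "(real \<Rightarrow> 'a \<Rightarrow> real) \<Rightarrow> 'a \<Rightarrow> ennreal" where
  "time_of_sup X \<omega> = (INF t\<in>{t. 0 \<le> t \<and> running_sup X t \<omega> = ultimate_sup X \<omega>}. ennreal t)"

text \<open>
  Subtraction on \<^typ>\<open>ennreal\<close> is truncated, so the distance is taken in \<^typ>\<open>ereal\<close>. The
  convention \<open>\<bar>\<infinity> - \<infinity>\<bar> = \<infinity>\<close> there plays no role below: \<^const>\<open>time_of_sup\<close> is
  almost surely finite if the process drifts to \<open>-\<infinity>\<close>. Since \<^const>\<open>nn_integral\<close> over
  \<open>M\<close> and over its completion agree for all integrands, measurability with respect to the
  completion suffices.
\<close>

definition expected_distance :: "'a measure \<Rightarrow> ('a \<Rightarrow> ennreal) \<Rightarrow> ('a \<Rightarrow> ennreal) \<Rightarrow> ennreal" where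
  "expected_distance M \<theta> \<tau> =
     (\<integral>\<^sup>+ \<omega>. e2ennreal \<bar>enn2ereal (\<theta> \<omega>) - enn2ereal (\<tau> \<omega>)\<bar> \<partial>M)"

end

theory Submission
  imports Defs
begin

text \<open>
  Write \<open>\<theta>\<close> for the time of the ultimate supremum. The point is that
  \<open>E[(\<theta> - \<tau>)\<^sup>+]\<close> is already infinite as soon as \<open>\<tau>\<close> is finite with positive probability; if
  \<open>\<tau> = \<infinity>\<close> almost surely, then the distance is almost surely infinite.

  Let \<open>d\<close> be a deterministic time and \<open>A\<close> an event of the past of \<open>d\<close> on which the past maximum
  exceeds \<open>X d\<close> by at most \<open>y\<close>. If the process restarted at \<open>d\<close> rises above \<open>y\<close>, then the
  supremum of \<open>X\<close> is reached after \<open>d\<close>, and \<open>\<theta> - d\<close> is the time of the supremum of the restarted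
  process. Hence, by the Markov property, \<open>E[(\<theta> - d)\<^sup>+; A] \<ge> P(A) * m y\<close>, where
  \<open>m y = E[\<theta>; sup X > y]\<close> (lemma \<open>mean_time_if_above_le_remaining_time\<close>).

  For a stopping time \<open>\<tau>\<close> that is finite with positive probability, there are a natural number \<open>n\<close>
  with \<open>P(\<tau> \<le> n) > 0\<close> and, as paths are locally bounded, an event \<open>A \<subseteq> {\<tau> \<le> n}\<close> of positive
  probability to which this applies with \<open>d = n + 1\<close> and some \<open>y\<close>. Since \<open>{\<tau> \<le> n}\<close> belongs to the
  completed past of \<open>n + 1\<close> by the definition of the enlarged filtration, the Markov property for
  completed pasts is enough. So it suffices that \<open>m y = \<infinity>\<close> for every \<open>y\<close>.

  This would follow from the strong Markov property at the first passage time above \<open>y\<close>, where the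
  path is at its running maximum: the restarted process has \<open>E \<theta> = \<infinity>\<close> again, so
  \<open>m y \<ge> P(sup X > y) * E \<theta>\<close>. Here that time is approximated by the first
  time of an equidistant grid at which the path exceeds \<open>y\<close>. It has countably many values, so the
  estimate at deterministic times applies to each of them, with an excess \<open>\<epsilon> > 0\<close> of the past
  maximum that right-continuity makes harmless as the mesh tends to 0. The result is
  \<open>m y \<ge> P(sup X > y) * m \<epsilon>\<close> (lemma \<open>mean_time_if_above_recursion\<close>), and
  \<open>m \<epsilon>\<close> increases to \<open>E \<theta> = \<infinity>\<close> as \<open>\<epsilon>\<close> tends to 0. Finally \<open>P(sup X > y) > 0\<close>: since \<open>\<theta>\<close> is not
  almost surely 0, some increment over a time \<open>q\<close> exceeds some \<open>\<delta> > 0\<close> with positive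
  probability, and independent repetitions of this event carry the path above every level.
\<close>

section \<open>The time of the supremum of a path\<close>

text \<open>
  \<open>overtaken T f r\<close> says that the supremum of \<open>f\<close> over the times up to \<open>r\<close> is strictly below the
  overall supremum. The margin \<open>1 / (n + 1)\<close> expresses strictness for suprema that are not
  attained, and it turns into a countable combination of closed conditions for countable \<open>T\<close>.
  The set \<open>T\<close> of times is a parameter so that real and rational times can be compared.
\<close>
definition overtaken :: "real set \<Rightarrow> (real \<Rightarrow> real) \<Rightarrow> real \<Rightarrow> bool" where
  "overtaken T f r \<longleftrightarrow> (\<exists>q\<in>T. \<exists>n::nat. \<forall>u\<in>T. u \<le> r \<longrightarrow> f u + 1 / real (Suc n) \<le> f q)"

definition last_overtaken :: "real set \<Rightarrow> (real \<Rightarrow> real) \<Rightarrow> ennreal" where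
  "last_overtaken T f = (SUP r\<in>{r\<in>T. overtaken T f r}. ennreal r)"

lemma overtaken_mono: "overtaken T f r \<Longrightarrow> s \<le> r \<Longrightarrow> overtaken T f s"
  unfolding overtaken_def by (meson order_trans)

lemma running_sup_mono: "s \<le> t \<Longrightarrow> running_sup X s \<omega> \<le> running_sup X t \<omega>"
  unfolding running_sup_def by (intro SUP_subset_mono) auto

lemma ultimate_sup_eq_SUP: "ultimate_sup X \<omega> = (SUP t. running_sup X t \<omega>)"
proof -
  have "((\<lambda>t. running_sup X t \<omega>) \<longlongrightarrow> (SUP t. running_sup X t \<omega>)) at_top"
  proof (rule order_tendstoI)
    fix a assume "a < (SUP t. running_sup X t \<omega>)"
    then obtain t where "a < running_sup X t \<omega>"
      by (auto simp: less_SUP_iff)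
    then show "\<forall>\<^sub>F s in at_top. a < running_sup X s \<omega>"
      unfolding eventually_at_top_linorder
      by (meson running_sup_mono less_le_trans)
  next
    fix a assume a: "(SUP t. running_sup X t \<omega>) < a"
    have "running_sup X s \<omega> \<le> (SUP t. running_sup X t \<omega>)" for s
      by (intro SUP_upper) auto
    then show "\<forall>\<^sub>F s in at_top. running_sup X s \<omega> < a"
      using a by (intro always_eventually) (blast intro: le_less_trans)
  qed
  then show ?thesis
    unfolding ultimate_sup_def by (intro tendsto_Lim) auto
qed

text \<open>
  The running supremum is a real number here: it lies above the value at time 0 and strictly below
  the value at some later time. So the gap to that value has positive length.
\<close>
lemma running_sup_less_ultimate_sup_iff:
  assumes "0 \<le> r"
  shows "running_sup X r \<omega> < ultimate_sup X \<omega> \<longleftrightarrow> overtaken {0..} (\<lambda>t. X t \<omega>) r"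
proof
  assume "running_sup X r \<omega> < ultimate_sup X \<omega>"
  then obtain t where "running_sup X r \<omega> < running_sup X t \<omega>"
    unfolding ultimate_sup_eq_SUP less_SUP_iff by auto
  then obtain q where q: "0 \<le> q" "running_sup X r \<omega> < ereal (X q \<omega>)"
    unfolding running_sup_def[of X t] less_SUP_iff by auto
  have "ereal (X 0 \<omega>) \<le> running_sup X r \<omega>"
    unfolding running_sup_def using assms by (intro SUP_upper) auto
  with q obtain c where c: "running_sup X r \<omega> = ereal c"
    by (cases "running_sup X r \<omega>") auto
  have le: "X u \<omega> \<le> c" if "0 \<le> u" "u \<le> r" for u
  proof -
    have "ereal (X u \<omega>) \<le> running_sup X r \<omega>"
      unfolding running_sup_def using that by (intro SUP_upper) auto
    then show ?thesis using c by simp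
  qed
  from q c have "0 < X q \<omega> - c" by simp
  then obtain n where "1 / real (Suc n) < X q \<omega> - c"
    using nat_approx_posE by blast
  then show "overtaken {0..} (\<lambda>t. X t \<omega>) r"
    unfolding overtaken_def using q le by (intro bexI[of _ q] exI[of _ n]) force+
next
  assume "overtaken {0..} (\<lambda>t. X t \<omega>) r"
  then obtain q n where q: "0 \<le> q" "\<And>u. 0 \<le> u \<Longrightarrow> u \<le> r \<Longrightarrow> X u \<omega> + 1 / real (Suc n) \<le> X q \<omega>"
    unfolding overtaken_def by auto
  have "running_sup X r \<omega> \<le> ereal (X q \<omega> - 1 / real (Suc n))"
    unfolding running_sup_def
  proof (rule SUP_least)
    fix u assume "u \<in> {0..r}"
    then show "ereal (X u \<omega>) \<le> ereal (X q \<omega> - 1 / real (Suc n))"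
      using q(2)[of u] by simp
  qed
  also have "\<dots> < ereal (X q \<omega>)" by simp
  also have "\<dots> \<le> running_sup X q \<omega>"
    unfolding running_sup_def using q by (intro SUP_upper) auto
  also have "\<dots> \<le> ultimate_sup X \<omega>"
    unfolding ultimate_sup_eq_SUP by (intro SUP_upper) auto
  finally show "running_sup X r \<omega> < ultimate_sup X \<omega>" .
qed

text \<open>
  The times at which the running supremum has reached its final value form an up-set of \<open>[0, \<infinity>)\<close>,
  and the overtaken times are its complement; the infimum of the one is the supremum of the other.
  If the up-set is empty, both are \<open>\<infinity>\<close>.
\<close>
lemma time_of_sup_eq_last_overtaken:
  "time_of_sup X \<omega> = last_overtaken {0..} (\<lambda>t. X t \<omega>)"
proof -
  let ?P = "overtaken {0..} (\<lambda>t. X t \<omega>)"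
  have eq_iff: "running_sup X t \<omega> = ultimate_sup X \<omega> \<longleftrightarrow> \<not> ?P t" if "0 \<le> t" for t
  proof -
    have "running_sup X t \<omega> \<le> ultimate_sup X \<omega>"
      unfolding ultimate_sup_eq_SUP by (intro SUP_upper) auto
    then show ?thesis
      using running_sup_less_ultimate_sup_iff[OF that, of X \<omega>] by (auto simp: less_le)
  qed
  have "{t. 0 \<le> t \<and> running_sup X t \<omega> = ultimate_sup X \<omega>} = {t. 0 \<le> t \<and> \<not> ?P t}"
    using eq_iff by blast
  then have "time_of_sup X \<omega> = (INF t\<in>{t. 0 \<le> t \<and> \<not> ?P t}. ennreal t)"
    unfolding time_of_sup_def by simp
  also have "\<dots> = (SUP r\<in>{r\<in>{0..}. ?P r}. ennreal r)"
  proof (rule antisym)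
    show "(INF t\<in>{t. 0 \<le> t \<and> \<not> ?P t}. ennreal t) \<le> (SUP r\<in>{r\<in>{0..}. ?P r}. ennreal r)"
    proof (rule ccontr)
      assume "\<not> ?thesis"
      then obtain c where c: "(SUP r\<in>{r\<in>{0..}. ?P r}. ennreal r) < c"
        "c < (INF t\<in>{t. 0 \<le> t \<and> \<not> ?P t}. ennreal t)"
        by (meson dense not_le)
      then have "c \<noteq> \<infinity>" by auto
      then obtain c' where c': "0 \<le> c'" "c = ennreal c'"
        by (cases c) auto
      show False
      proof (cases "?P c'")
        case True
        then have "c \<le> (SUP r\<in>{r\<in>{0..}. ?P r}. ennreal r)"
          unfolding c' using c' by (intro SUP_upper) auto
        with c show False by simp
      next
        case False
        then have "(INF t\<in>{t. 0 \<le> t \<and> \<not> ?P t}. ennreal t) \<le> c"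
          unfolding c' using c' by (intro INF_lower) auto
        with c show False by simp
      qed
    qed
    show "(SUP r\<in>{r\<in>{0..}. ?P r}. ennreal r) \<le> (INF t\<in>{t. 0 \<le> t \<and> \<not> ?P t}. ennreal t)"
      using overtaken_mono by (intro SUP_least INF_greatest ennreal_leI) (force intro: leI)
  qed
  finally show ?thesis
    unfolding last_overtaken_def .
qed

section \<open>Reduction to rational times\<close>

definition rat_times :: "real set" where
  "rat_times = {q\<in>\<rat>. 0 \<le> q}"

lemma countable_rat_times [simp]: "countable rat_times"
  unfolding rat_times_def using countable_rat by (rule countable_subset[rotated]) auto

lemma rat_times_nonneg: "q \<in> rat_times \<Longrightarrow> 0 \<le> q"
  by (simp add: rat_times_def)

lemma right_continuous_rat_approx:
  assumes "(f \<longlongrightarrow> f t) (at_right t)" "0 \<le> t" "t < b" "open U" "f t \<in> U"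
  obtains q where "q \<in> rat_times" "t < q" "q < b" "f q \<in> U"
proof -
  have "\<forall>\<^sub>F s in at_right t. f s \<in> U"
    using assms topological_tendstoD by blast
  then obtain c where c: "c > t" "\<And>s. t < s \<Longrightarrow> s < c \<Longrightarrow> f s \<in> U"
    unfolding eventually_at_right_field by auto
  obtain q where "q \<in> \<rat>" "t < q" "q < min b c"
    using Rats_dense_in_real[of t "min b c"] assms c by auto
  then show ?thesis using that[of q] c assms by (auto simp: rat_times_def)
qed

lemma right_continuous_le_on_rats:
  assumes rc: "\<And>t. 0 \<le> t \<Longrightarrow> (f \<longlongrightarrow> f t) (at_right t)"
    and le: "\<And>u. u \<in> rat_times \<Longrightarrow> u \<le> r \<Longrightarrow> f u \<le> c"
    and r: "r \<in> rat_times" and u: "0 \<le> u" "u \<le> r"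
  shows "f u \<le> (c::real)"
proof (rule ccontr)
  assume "\<not> f u \<le> c"
  then have "f u \<in> {c<..}" by auto
  moreover have "u < r" using le[OF r] u \<open>\<not> f u \<le> c\<close> by (cases "u = r") auto
  ultimately obtain q where "q \<in> rat_times" "u < q" "q < r" "f q \<in> {c<..}"
    using right_continuous_rat_approx[OF rc[OF u(1)] u(1), of r "{c<..}"] by auto
  then show False using le[of q] by auto
qed

text \<open>
  Right-continuity moves a bound from rational to real times up to \<open>r\<close> because \<open>r\<close> itself is rational.
  In the other direction the later time is shifted to a rational one, at the price of a smaller margin.
\<close>
lemma overtaken_rat_times_iff:
  assumes rc: "\<And>t. 0 \<le> t \<Longrightarrow> (f \<longlongrightarrow> f t) (at_right t)" and r: "r \<in> rat_times"
  shows "overtaken rat_times f r \<longleftrightarrow> overtaken {0..} f r"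
proof
  assume "overtaken rat_times f r"
  then obtain q n where q: "q \<in> rat_times"
    and n: "\<And>u. u \<in> rat_times \<Longrightarrow> u \<le> r \<Longrightarrow> f u \<le> f q - 1 / real (Suc n)"
    unfolding overtaken_def by (auto simp: algebra_simps)
  have "f u \<le> f q - 1 / real (Suc n)" if "0 \<le> u" "u \<le> r" for u
    by (rule right_continuous_le_on_rats[OF rc n r that])
  then show "overtaken {0..} f r"
    unfolding overtaken_def using rat_times_nonneg[OF q]
    by (intro bexI[of _ q] exI[of _ n]) (auto simp: algebra_simps)
next
  assume "overtaken {0..} f r"
  then obtain q n where q: "0 \<le> q" and n: "\<And>u. 0 \<le> u \<Longrightarrow> u \<le> r \<Longrightarrow> f u + 1 / real (Suc n) \<le> f q"
    unfolding overtaken_def by auto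
  \<comment> \<open>The loss allowed at the new time is the difference of two consecutive margins.\<close>
  have "f q \<in> {f q - (1 / real (Suc n) - 1 / real (Suc (Suc n)))<..}"
    by (simp add: frac_less2)
  then obtain q' where q': "q' \<in> rat_times"
    "f q' \<in> {f q - (1 / real (Suc n) - 1 / real (Suc (Suc n)))<..}"
    using right_continuous_rat_approx[OF rc[OF q] q, of "q + 1"
      "{f q - (1 / real (Suc n) - 1 / real (Suc (Suc n)))<..}"] by auto
  have "f u + 1 / real (Suc (Suc n)) \<le> f q'" if "u \<in> rat_times" "u \<le> r" for u
    using n[OF rat_times_nonneg[OF that(1)] that(2)] q'(2) by simp
  then show "overtaken rat_times f r"
    unfolding overtaken_def using q' by blast
qed

lemma last_overtaken_rat_times:
  assumes rc: "\<And>t. 0 \<le> t \<Longrightarrow> (f \<longlongrightarrow> f t) (at_right t)"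
  shows "last_overtaken {0..} f = last_overtaken rat_times f"
proof (rule antisym)
  show "last_overtaken rat_times f \<le> last_overtaken {0..} f"
    unfolding last_overtaken_def
    using overtaken_rat_times_iff[OF rc] rat_times_nonneg by (intro SUP_subset_mono) auto
  show "last_overtaken {0..} f \<le> last_overtaken rat_times f"
    unfolding last_overtaken_def
  proof (rule SUP_least)
    fix r assume r: "r \<in> {r\<in>{0..}. overtaken {0..} f r}"
    show "ennreal r \<le> (SUP r\<in>{r\<in>rat_times. overtaken rat_times f r}. ennreal r)"
    proof (rule dense_le)
      fix c assume "c < ennreal r"
      then obtain c' where c': "c = ennreal c'" "0 \<le> c'" "c' < r"
        by (cases c) (auto simp: ennreal_less_iff)
      obtain q where q: "q \<in> \<rat>" "c' < q" "q < r"
        using Rats_dense_in_real c' by blast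
      then have qt: "q \<in> rat_times" using c' by (auto simp: rat_times_def)
      have "overtaken rat_times f q"
        using overtaken_rat_times_iff[OF rc qt] overtaken_mono[of "{0..}" f r q] r q by auto
      have "c \<le> ennreal q" using c' q by (auto intro: ennreal_leI)
      also have "\<dots> \<le> (SUP r\<in>{r\<in>rat_times. overtaken rat_times f r}. ennreal r)"
        using qt \<open>overtaken rat_times f q\<close> by (intro SUP_upper) auto
      finally show "c \<le> \<dots>" .
    qed
  qed
qed

abbreviation rat_paths :: "(real \<Rightarrow> real) measure" where
  "rat_paths \<equiv> Pi\<^sub>M rat_times (\<lambda>_. borel)"

lemma last_overtaken_measurable [measurable]:
  "last_overtaken rat_times \<in> borel_measurable rat_paths"
proof -
  have [measurable]: "(\<lambda>f. f q) \<in> borel_measurable rat_paths" if "q \<in> rat_times" for q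
    using that by measurable
  have [measurable]: "Measurable.pred rat_paths (\<lambda>f. overtaken rat_times f r)" for r
  proof -
    have "Measurable.pred rat_paths (\<lambda>f. \<exists>q\<in>rat_times. \<exists>n::nat. \<forall>u\<in>{u\<in>rat_times. u \<le> r}.
        f u + 1 / real (Suc n) \<le> f q)"
    proof (intro measurable_pred_countable pred_intros_countable)
      fix q n u assume "q \<in> rat_times" "u \<in> {u \<in> rat_times. u \<le> r}"
      then show "Measurable.pred rat_paths (\<lambda>f. f u + 1 / real (Suc n) \<le> f q)"
        unfolding pred_def
        by (intro borel_measurable_le borel_measurable_add borel_measurable_const measurable_component_singleton) auto
    qed (auto intro: countable_subset[OF _ countable_rat_times])
    then show ?thesis
      unfolding overtaken_def by (simp add: Ball_def imp_conjL)
  qed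
  have eq: "last_overtaken rat_times f = (SUP r\<in>rat_times. ennreal r * indicator {f. overtaken rat_times f r} f)" for f
    unfolding last_overtaken_def
    apply (rule antisym)
    subgoal by (rule SUP_mono) (auto intro!: bexI)
    subgoal by (rule SUP_least) (auto simp: indicator_def intro!: SUP_upper)
    done
  show ?thesis
    unfolding eq[abs_def] by measurable
qed

lemma overtaken_cong: "(\<And>q. q \<in> T \<Longrightarrow> f q = g q) \<Longrightarrow> overtaken T f r = overtaken T g r"
  unfolding overtaken_def by simp

lemma last_overtaken_cong: "(\<And>q. q \<in> T \<Longrightarrow> f q = g q) \<Longrightarrow> last_overtaken T f = last_overtaken T g"
  unfolding last_overtaken_def using overtaken_cong[of T f g] by simp

lemma zero_in_rat_times [simp]: "0 \<in> rat_times"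
  by (simp add: rat_times_def)

lemma last_overtaken_eq_0:
  assumes "\<And>q. q \<in> rat_times \<Longrightarrow> f q \<le> f 0"
  shows "last_overtaken rat_times f = 0"
proof -
  have "\<not> overtaken rat_times f r" if r: "r \<in> rat_times" for r
  proof
    assume "overtaken rat_times f r"
    then obtain q n where "q \<in> rat_times" "f 0 + 1 / real (Suc n) \<le> f q"
      unfolding overtaken_def using rat_times_nonneg[OF r] by force
    moreover have "0 < 1 / real (Suc n)" by simp
    ultimately show False using assms[of q] by linarith
  qed
  then have "{r\<in>rat_times. overtaken rat_times f r} = {}" by auto
  then show ?thesis unfolding last_overtaken_def by (simp only: image_empty Sup_empty bot_ennreal)
qed

definition rises_above :: "real \<Rightarrow> (real \<Rightarrow> real) set" where
  "rises_above y = {f. \<exists>q\<in>rat_times. y < f q}"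

lemma rises_above_measurable [measurable]: "Measurable.pred rat_paths (\<lambda>f. f \<in> rises_above y)"
proof -
  have "Measurable.pred rat_paths (\<lambda>f. \<exists>q\<in>rat_times. y < f q)"
  proof (intro measurable_pred_countable)
    fix q assume "q \<in> rat_times"
    then show "Measurable.pred rat_paths (\<lambda>f. y < f q)"
      unfolding pred_def
      by (intro borel_measurable_less borel_measurable_const measurable_component_singleton)
  qed simp
  then show ?thesis by (simp add: rises_above_def)
qed

section \<open>Deterministic properties of paths\<close>

lemma right_continuous_shift:
  assumes f: "cadlag f" and d: "0 \<le> d" "0 \<le> t"
  shows "((\<lambda>t. f (d + t) - f d) \<longlongrightarrow> f (d + t) - f d) (at_right t)"
proof -
  have "(f \<longlongrightarrow> f (d + t)) (at_right (d + t))" using f d by (auto simp: cadlag_def)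
  moreover have "filterlim (\<lambda>s. d + s) (at_right (d + t)) (at_right t)"
    unfolding filterlim_at
    by (auto intro!: tendsto_intros simp: eventually_at_filter)
  ultimately have "((\<lambda>s. f (d + s)) \<longlongrightarrow> f (d + t)) (at_right t)"
    by (rule filterlim_compose)
  then show ?thesis by (intro tendsto_intros)
qed

text \<open>
  At an overtaken time \<open>r\<close> of the restarted path, the past up to \<open>d\<close> is at most \<open>f d + \<epsilon>\<close> and hence
  below the value at \<open>d + q\<close>, and the part between \<open>d\<close> and \<open>d + r\<close> is below
  the value at another later time. The larger of the two values overtakes everything up to \<open>d + r\<close>.
\<close>
lemma overtaken_shift:
  assumes d: "0 \<le> d" and r: "0 \<le> r"
    and le: "\<And>u. 0 \<le> u \<Longrightarrow> u \<le> d \<Longrightarrow> f u \<le> f d + \<epsilon>"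
    and ex: "0 \<le> q" "f d + \<epsilon> < f (d + q)"
    and ov: "overtaken {0..} (\<lambda>t. f (d + t) - f d) r"
  shows "overtaken {0..} f (d + r)"
proof -
  obtain p n where p: "0 \<le> p" "\<And>u. 0 \<le> u \<Longrightarrow> u \<le> r \<Longrightarrow> f (d + u) + 1 / real (Suc n) \<le> f (d + p)"
    using ov unfolding overtaken_def by force
  obtain m where m: "1 / real (Suc m) < f (d + q) - (f d + \<epsilon>)"
    using nat_approx_posE[of "f (d + q) - (f d + \<epsilon>)"] ex by auto
  define q' where "q' = (if f (d + p) \<le> f (d + q) then q else p)"
  have q': "0 \<le> q'" "f (d + p) \<le> f (d + q')" "f (d + q) \<le> f (d + q')"
    using p ex by (auto simp: q'_def)
  have k: "1 / real (Suc (max m n)) \<le> 1 / real (Suc m)"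
    "1 / real (Suc (max m n)) \<le> 1 / real (Suc n)"
    by (auto intro!: divide_left_mono)
  have "f u + 1 / real (Suc (max m n)) \<le> f (d + q')" if u: "0 \<le> u" "u \<le> d + r" for u
  proof (cases "u \<le> d")
    case True
    show ?thesis using le[OF u(1) True] m q' k by linarith
  next
    case False
    have "f u + 1 / real (Suc n) \<le> f (d + p)"
      using p(2)[of "u - d"] False u by (simp add: algebra_simps)
    then show ?thesis using q' k by linarith
  qed
  then show ?thesis
    unfolding overtaken_def using q' d by (intro bexI[of _ "d + q'"] exI[of _ "max m n"]) auto
qed

lemma last_overtaken_shift_le:
  assumes d: "0 \<le> d"
    and le: "\<And>u. 0 \<le> u \<Longrightarrow> u \<le> d \<Longrightarrow> f u \<le> f d + \<epsilon>"
    and ex: "0 \<le> q" "f d + \<epsilon> < f (d + q)"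
  shows "last_overtaken {0..} (\<lambda>t. f (d + t) - f d) \<le> last_overtaken {0..} f - ennreal d"
  unfolding last_overtaken_def[of _ "\<lambda>t. f (d + t) - f d"]
proof (rule SUP_least)
  fix r assume r: "r \<in> {r\<in>{0..}. overtaken {0..} (\<lambda>t. f (d + t) - f d) r}"
  then have "overtaken {0..} f (d + r)"
    using overtaken_shift[OF d _ le ex] by auto
  then have "ennreal (d + r) \<le> last_overtaken {0..} f"
    unfolding last_overtaken_def using d r by (intro SUP_upper) auto
  then have "ennreal (d + r) - ennreal d \<le> last_overtaken {0..} f - ennreal d"
    by (rule ennreal_minus_mono) simp
  then show "ennreal r \<le> last_overtaken {0..} f - ennreal d"
    using d r by (simp add: ennreal_minus)
qed

text \<open>
  One-sided limits bound the path near each point, and finitely many neighbourhoods cover \<open>[0, d]\<close>.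
\<close>
lemma cadlag_bounded_above:
  assumes f: "cadlag f"
  shows "\<exists>c. \<forall>u\<in>{0..d}. f u \<le> c"
proof -
  have "\<exists>U c. open U \<and> t \<in> U \<and> (\<forall>u\<in>U. 0 \<le> u \<longrightarrow> f u \<le> c)" if t: "t \<in> {0..d}" for t
  proof -
    have "\<exists>c. \<forall>\<^sub>F u in at_left t. 0 \<le> u \<longrightarrow> f u \<le> c"
    proof (cases "t = 0")
      case True
      have "\<forall>\<^sub>F u in at_left t. u < t" by (auto simp: eventually_at_filter)
      then have "\<forall>\<^sub>F u in at_left t. 0 \<le> u \<longrightarrow> f u \<le> 0"
        by eventually_elim (use True in auto)
      then show ?thesis by blast
    next
      case False
      with t have "0 < t" by auto
      then obtain l where "(f \<longlongrightarrow> l) (at_left t)"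
        using f by (auto simp: cadlag_def)
      then have "\<forall>\<^sub>F u in at_left t. f u < l + 1" by (rule order_tendstoD) simp
      then show ?thesis by (auto intro!: exI[of _ "l+1"] elim: eventually_mono)
    qed
    then obtain c where c: "\<forall>\<^sub>F u in at_left t. 0 \<le> u \<longrightarrow> f u \<le> c" ..
    have "(f \<longlongrightarrow> f t) (at_right t)" using f t by (auto simp: cadlag_def)
    then have "\<forall>\<^sub>F u in at_right t. f u < f t + 1" by (rule order_tendstoD) simp
    then have "\<forall>\<^sub>F u in at_right t. 0 \<le> u \<longrightarrow> f u \<le> max c (f t + 1)"
      by (auto elim: eventually_mono)
    moreover have "\<forall>\<^sub>F u in at_left t. 0 \<le> u \<longrightarrow> f u \<le> max c (f t + 1)"
      using c by (auto elim: eventually_mono)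
    ultimately have "\<forall>\<^sub>F u in at t. 0 \<le> u \<longrightarrow> f u \<le> max c (f t + 1)"
      by (simp add: eventually_at_split)
    then obtain U where "open U" "t \<in> U" "\<forall>u\<in>U. u \<noteq> t \<longrightarrow> 0 \<le> u \<longrightarrow> f u \<le> max c (f t + 1)"
      by (auto simp: eventually_at_topological)
    then show ?thesis
      by (intro exI[of _ U] exI[of _ "max c (f t + 1)"]) force
  qed
  then obtain U c where U: "\<And>t. t \<in> {0..d} \<Longrightarrow> open (U t) \<and> t \<in> U t \<and> (\<forall>u\<in>U t. 0 \<le> u \<longrightarrow> f u \<le> c t)"
    by metis
  have "compact {0..d}" by simp
  then obtain D where D: "D \<subseteq> {0..d}" "finite D" "{0..d} \<subseteq> (\<Union>t\<in>D. U t)"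
    by (rule compactE_image[of _ "{0..d}" U]) (use U in auto)
  have "f u \<le> Max (c ` D)" if u: "u \<in> {0..d}" for u
  proof -
    obtain t where "t \<in> D" "u \<in> U t" using D u by blast
    then have "f u \<le> c t" using U[of t] D u by auto
    also have "\<dots> \<le> Max (c ` D)" using D \<open>t \<in> D\<close> by (intro Max_ge) auto
    finally show ?thesis .
  qed
  then show ?thesis by blast
qed

text \<open>
  Let \<open>T\<close> be the first passage time above \<open>y\<close>. Before \<open>T\<close> the path is at most \<open>y\<close>, and shortly after \<open>T\<close>
  it stays within \<open>\<epsilon> / 2\<close> of \<open>f T\<close>. Arbitrarily soon after \<open>T\<close> there is a whole interval on which the path exceeds
  \<open>y\<close>; it contains a grid point once the mesh is small. So the first grid point with value
  above \<open>y\<close> lies in the short interval after \<open>T\<close>, and there the path is within \<open>\<epsilon>\<close> of its past maximum.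
\<close>
lemma eventually_grid_exceeds:
  fixes f :: "real \<Rightarrow> real"
  assumes rc: "\<And>t. 0 \<le> t \<Longrightarrow> (f \<longlongrightarrow> f t) (at_right t)"
    and ex: "0 \<le> q" "y < f q" and eps: "0 < \<epsilon>" 
  shows "\<forall>\<^sub>F n in sequentially. \<exists>i. y < f (real i / real (Suc n)) \<and> (\<forall>j<i. f (real j / real (Suc n)) \<le> y) \<and>
     (\<forall>u. 0 \<le> u \<longrightarrow> u \<le> real i / real (Suc n) \<longrightarrow> f u \<le> f (real i / real (Suc n)) + \<epsilon>)"
proof -
  define S where "S = {t. 0 \<le> t \<and> y < f t}"
  define T where "T = Inf S"
  have S: "S \<noteq> {}" "bdd_below S" using ex by (auto simp: S_def intro!: bdd_belowI[of _ 0])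
  have T0: "0 \<le> T" unfolding T_def using S by (intro cInf_greatest) (auto simp: S_def)
  have below: "f u \<le> y" if "0 \<le> u" "u < T" for u
  proof (rule ccontr)
    assume "\<not> f u \<le> y"
    then have "T \<le> u"
      unfolding T_def using that S by (intro cInf_lower) (simp_all add: S_def)
    with that show False by simp
  qed
  have "\<forall>\<^sub>F u in at_right T. f u \<in> {f T - \<epsilon>/2<..<f T + \<epsilon>/2}"
    by (intro topological_tendstoD[OF rc[OF T0]]) (use eps in auto)
  then obtain b where b: "b > T" "\<And>u. T < u \<Longrightarrow> u < b \<Longrightarrow> f T - \<epsilon>/2 < f u \<and> f u < f T + \<epsilon>/2"
    unfolding eventually_at_right_field by auto
  have near: "f T - \<epsilon>/2 < f u \<and> f u < f T + \<epsilon>/2" if "T \<le> u" "u < b" for u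
    using b(2)[of u] that eps by (cases "u = T") auto
  obtain t where t: "t \<in> S" "t < b"
    using cInf_lessD[OF S(1), of b] b unfolding T_def by auto
  have Tt: "T \<le> t" unfolding T_def using t S by (intro cInf_lower) auto
  have t0: "0 \<le> t" "y < f t" using t by (auto simp: S_def)
  have "\<forall>\<^sub>F u in at_right t. f u \<in> {y<..}"
    by (intro topological_tendstoD[OF rc[OF t0(1)]]) (use t0 in auto)
  then obtain c where c: "c > t" "\<And>u. t < u \<Longrightarrow> u < c \<Longrightarrow> y < f u"
    unfolding eventually_at_right_field by auto
  define h where "h = min b c - t"
  have h: "0 < h" using t c by (auto simp: h_def)
  have yT: "y \<le> f T + \<epsilon>/2" using near[OF Tt t(2)] t0 by linarith
  have "\<forall>\<^sub>F n in sequentially. 1 / real (Suc n) < h"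
    using order_tendstoD(2)[OF LIMSEQ_inverse_real_of_nat h] by (simp add: inverse_eq_divide)
  then show ?thesis
  proof eventually_elim
    case (elim n)
    let ?g = "\<lambda>i. real i / real (Suc n)"
    \<comment> \<open>The first grid point after \<open>t\<close>; it lies in the interval on which the path exceeds \<open>y\<close>.\<close>
    define k where "k = nat \<lfloor>t * real (Suc n)\<rfloor> + 1"
    have fl: "real_of_int \<lfloor>t * real (Suc n)\<rfloor> \<le> t * real (Suc n)"
      "t * real (Suc n) < real_of_int \<lfloor>t * real (Suc n)\<rfloor> + 1"
      by linarith+
    have "real k = real_of_int \<lfloor>t * real (Suc n)\<rfloor> + 1"
      using t0 unfolding k_def by simp
    with fl have "t * real (Suc n) < real k" "real k \<le> t * real (Suc n) + 1" by simp_all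
    then have k: "t < ?g k" "?g k \<le> t + 1 / real (Suc n)"
      by (simp_all add: field_simps del: of_nat_Suc)
    define i where "i = (LEAST i. y < f (?g i))"
    have fk: "y < f (?g k)" using c(2)[of "?g k"] k elim by (auto simp: h_def)
    have i: "y < f (?g i)" "i \<le> k" "\<And>j. j < i \<Longrightarrow> f (?g j) \<le> y"
      using LeastI[of "\<lambda>i. y < f (?g i)", OF fk] Least_le[of "\<lambda>i. y < f (?g i)", OF fk]
        not_less_Least[of _ "\<lambda>i. y < f (?g i)"] unfolding i_def by (auto simp: not_less)
    have gi: "?g i < b" 
    proof -
      have "?g i \<le> ?g k" using i by (intro divide_right_mono) auto
      then show ?thesis using k elim by (auto simp: h_def)
    qed
    have "f u \<le> f (?g i) + \<epsilon>" if u: "0 \<le> u" "u \<le> ?g i" for u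
    proof -
      have "T \<le> ?g i" using below[of "?g i"] i by force
      then have "f T - \<epsilon>/2 < f (?g i)" using near gi by auto
      moreover have "f u \<le> f T + \<epsilon>/2"
      proof (cases "u < T")
        case True
        then show ?thesis using below[OF u(1)] yT by linarith
      next
        case False
        then show ?thesis using near[of u] u gi by auto
      qed
      ultimately show ?thesis by linarith
    qed
    with i show ?case by blast
  qed
qed

section \<open>The Markov property at deterministic times\<close>

lemma finite_times_grid:
  fixes L :: "real set"
  assumes L: "finite L" "L \<subseteq> {0..b}" and b: "0 \<le> b"
  obtains t :: "nat \<Rightarrow> real" and n where
    "mono t" "t 0 = 0" "t n = b" "L \<subseteq> t ` {..n}"
proof -
  define xs where "xs = sorted_list_of_set (insert 0 L)"
  have xs: "sorted xs" "set xs = insert 0 L"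
    using L by (simp_all add: xs_def del: sorted_list_of_set_insert_remove)
  define t where "t i = (if i < length xs then xs ! i else b)" for i
  have le_b: "xs ! i \<le> b" "0 \<le> xs ! i" if "i < length xs" for i
    using nth_mem[OF that] xs L b by auto
  show ?thesis
  proof (rule that)
    show "mono t"
      unfolding mono_def t_def using sorted_nth_mono[OF xs(1)] le_b by auto
    obtain j where j: "j < length xs" "xs ! j = 0"
      using xs by (metis in_set_conv_nth insertI1)
    then have "xs ! 0 \<le> 0" using sorted_nth_mono[OF xs(1), of 0 j] by auto
    then show "t 0 = 0" using j le_b[of 0] by (auto simp: t_def)
    show "t (length xs) = b" by (simp add: t_def)
    show "L \<subseteq> t ` {..length xs}"
    proof
      fix u assume "u \<in> L"
      then obtain j where "j < length xs" "xs ! j = u"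
        using xs by (metis in_set_conv_nth insertCI)
      then show "u \<in> t ` {..length xs}" by (auto simp: t_def intro!: image_eqI[of _ _ j])
    qed
  qed
qed

context levy_process
begin

lemma distr_increments:
  assumes t: "mono t" "0 \<le> t 0" and d: "0 \<le> d" and n: "0 < n"
  shows "distr M (Pi\<^sub>M {..<n} (\<lambda>_. borel)) (\<lambda>\<omega>. \<lambda>i\<in>{..<n}. X (d + t (Suc i)) \<omega> - X (d + t i) \<omega>) =
    Pi\<^sub>M {..<n} (\<lambda>i. distr M borel (X (t (Suc i) - t i)))"
proof -
  have t0: "0 \<le> t i" for i using t monoD[OF t(1), of 0 i] by simp
  have tS: "t i \<le> t (Suc i)" for i using monoD[OF t(1)] by simp
  have "indep_vars (\<lambda>_. borel) (\<lambda>i \<omega>. X (d + t (Suc i)) \<omega> - X (d + t i) \<omega>) {..<n}"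
    using indep_increments[of "\<lambda>i. d + t i" n] t d by (auto simp: mono_def)
  then have "distr M (Pi\<^sub>M {..<n} (\<lambda>_. borel)) (\<lambda>\<omega>. \<lambda>i\<in>{..<n}. X (d + t (Suc i)) \<omega> - X (d + t i) \<omega>) =
    Pi\<^sub>M {..<n} (\<lambda>i. distr M borel (\<lambda>\<omega>. X (d + t (Suc i)) \<omega> - X (d + t i) \<omega>))"
    using n d t0
      by (subst (asm) indep_vars_iff_distr_eq_PiM') (auto intro!: random_variable_X borel_measurable_diff)
  also have "\<dots> = Pi\<^sub>M {..<n} (\<lambda>i. distr M borel (X (t (Suc i) - t i)))"
  proof (intro PiM_cong refl)
    fix i
    show "distr M borel (\<lambda>\<omega>. X (d + t (Suc i)) \<omega> - X (d + t i) \<omega>) = distr M borel (X (t (Suc i) - t i))"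
      using stationary_increments[of "d + t i" "t (Suc i) - t i"] d t0[of i] tS[of i]
      by (simp add: algebra_simps)
  qed
  finally show ?thesis .
qed

text \<open>
  On a grid the increments of the restarted process are independent with the same marginals as those
  of the original process, so both vectors have the same product law.
\<close>
lemma prob_future_cylinder:
  assumes d: "0 \<le> d" and K: "finite K" "K \<subseteq> {0..}" and C: "\<And>q. q \<in> K \<Longrightarrow> C q \<in> sets borel"
  shows "prob {\<omega>\<in>space M. \<forall>q\<in>K. X (d + q) \<omega> - X d \<omega> \<in> C q} =
    prob {\<omega>\<in>space M. \<forall>q\<in>K. X q \<omega> - X 0 \<omega> \<in> C q}"
proof -
  have "K \<subseteq> {0..Max (insert 0 K)}" using K by auto
  then obtain t and n :: nat where t: "mono t" "t 0 = 0" "K \<subseteq> t ` {..n}"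
    by (rule finite_times_grid[OF K(1)]) (use K in auto)
  then obtain i where i: "\<And>q. q \<in> K \<Longrightarrow> i q \<le> n \<and> t (i q) = q"
    by (metis atMost_iff image_iff subset_iff)
  have t0: "0 \<le> t i" for i using t monoD[OF t(1), of 0 i] by simp
  let ?P = "Pi\<^sub>M {..<Suc n} (\<lambda>_. borel) :: (nat \<Rightarrow> real) measure"
  let ?V = "\<lambda>d \<omega>. \<lambda>i\<in>{..<Suc n}. X (d + t (Suc i)) \<omega> - X (d + t i) \<omega>"
  define W where "W = {v\<in>space ?P. \<forall>q\<in>K. (\<Sum>j<i q. v j) \<in> C q}"
  have [measurable]: "W \<in> sets ?P"
    unfolding W_def
  proof (intro sets.sets_Collect_finite_All K)
    fix q assume q: "q \<in> K"
    have "(\<lambda>v. \<Sum>j<i q. v j) \<in> borel_measurable ?P"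
      using i[OF q] by (intro borel_measurable_sum measurable_component_singleton) auto
    then show "{v\<in>space ?P. (\<Sum>j<i q. v j) \<in> C q} \<in> sets ?P"
      using C[OF q] by measurable
  qed
  have law: "prob {\<omega>\<in>space M. \<forall>q\<in>K. X (c + q) \<omega> - X c \<omega> \<in> C q} = measure (distr M ?P (?V c)) W" if c: "0 \<le> c" for c
  proof -
    have [measurable]: "?V c \<in> measurable M ?P"
      using c t0 by (intro measurable_restrict borel_measurable_diff random_variable_X) auto
    have tele: "(\<Sum>j<i q. ?V c \<omega> j) = X (c + q) \<omega> - X c \<omega>" if "q \<in> K" for q \<omega>
    proof -
      have "(\<Sum>j<i q. ?V c \<omega> j) = (\<Sum>j<i q. X (c + t (Suc j)) \<omega> - X (c + t j) \<omega>)"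
        using i[OF that] by (intro sum.cong) auto
      also have "\<dots> = X (c + q) \<omega> - X c \<omega>"
        using i[OF that] t(2) by (subst sum_lessThan_telescope) auto
      finally show ?thesis .
    qed
    have "?V c -` W \<inter> space M = {\<omega>\<in>space M. \<forall>q\<in>K. X (c + q) \<omega> - X c \<omega> \<in> C q}"
      unfolding W_def using tele measurable_space[OF \<open>?V c \<in> measurable M ?P\<close>] by auto
    then show ?thesis by (simp add: measure_distr)
  qed
  show ?thesis
    using law[OF d] law[of 0] distr_increments[OF t(1) _ d, of "Suc n"] distr_increments[OF t(1), of 0 "Suc n"] t
    by simp
qed

text \<open>
  A grid of \<open>[0, d]\<close> followed by a shifted grid of the future splits the increments into two
  disjoint blocks: the first determines the past cylinder, the second the future one.
\<close>
lemma prob_past_future_cylinder: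
  assumes d: "0 \<le> d" and J: "finite J" "J \<subseteq> {0..d}" and B: "\<And>u. u \<in> J \<Longrightarrow> B u \<in> sets borel"
    and K: "finite K" "K \<subseteq> {0..}" and C: "\<And>q. q \<in> K \<Longrightarrow> C q \<in> sets borel"
  shows "prob {\<omega>\<in>space M. (\<forall>u\<in>J. X u \<omega> - X 0 \<omega> \<in> B u) \<and> (\<forall>q\<in>K. X (d + q) \<omega> - X d \<omega> \<in> C q)} =
    prob {\<omega>\<in>space M. \<forall>u\<in>J. X u \<omega> - X 0 \<omega> \<in> B u} *
    prob {\<omega>\<in>space M. \<forall>q\<in>K. X q \<omega> - X 0 \<omega> \<in> C q}"
proof -
  obtain t1 and n1 :: nat where t1: "mono t1" "t1 0 = 0" "t1 n1 = d" "J \<subseteq> t1 ` {..n1}"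
    by (rule finite_times_grid[OF J d])
  have "K \<subseteq> {0..Max (insert 0 K)}" using K by auto
  then obtain t2 and n2 :: nat where t2: "mono t2" "t2 0 = 0" "K \<subseteq> t2 ` {..n2}"
    by (rule finite_times_grid[OF K(1)]) (use K in auto)
  obtain i1 where i1: "\<And>u. u \<in> J \<Longrightarrow> i1 u \<le> n1 \<and> t1 (i1 u) = u"
    using t1 by (metis atMost_iff image_iff subset_iff)
  obtain i2 where i2: "\<And>q. q \<in> K \<Longrightarrow> i2 q \<le> n2 \<and> t2 (i2 q) = q"
    using t2 by (metis atMost_iff image_iff subset_iff)
  define t where "t i = (if i \<le> n1 then t1 i else d + t2 (i - n1))" for i
  have t2_0: "0 \<le> t2 i" for i using t2 monoD[OF t2(1), of 0 i] by simp
  have t1_d: "t1 i \<le> d" if "i \<le> n1" for i using t1 monoD[OF t1(1) that] by simp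
  have t: "mono t"
  proof (rule monoI)
    fix i j :: nat assume "i \<le> j"
    then show "t i \<le> t j"
      unfolding t_def
        using monoD[OF t1(1), of i j] monoD[OF t2(1), of "i - n1" "j - n1"] t1_d[of i] t2_0[of "j - n1"]
      by auto
  qed
  have t_fut: "t (n1 + i) = d + t2 i" for i
    using t1 t2 by (cases i) (auto simp: t_def)
  have t_0: "t 0 = 0" using t1 by (simp add: t_def)
  have t0: "0 \<le> t i" for i using t_0 monoD[OF t, of 0 i] by simp
  define n where "n = n1 + n2"
  define D where "D i \<omega> = X (t (Suc i)) \<omega> - X (t i) \<omega>" for i \<omega>
  have "indep_vars (\<lambda>_. borel) D {..<n}"
    using indep_increments[OF t, of n] t_0 by (simp add: D_def[abs_def])
  then have ind: "indep_var (Pi\<^sub>M {..<n1} (\<lambda>_. borel)) (\<lambda>\<omega>. restrict (\<lambda>i. D i \<omega>) {..<n1})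
      (Pi\<^sub>M {n1..<n} (\<lambda>_. borel)) (\<lambda>\<omega>. restrict (\<lambda>i. D i \<omega>) {n1..<n})"
    by (rule indep_var_restrict) (auto simp: n_def)
  let ?P1 = "Pi\<^sub>M {..<n1} (\<lambda>_. borel) :: (nat \<Rightarrow> real) measure"
  let ?P2 = "Pi\<^sub>M {n1..<n} (\<lambda>_. borel) :: (nat \<Rightarrow> real) measure"
  let ?V1 = "\<lambda>\<omega>. restrict (\<lambda>i. D i \<omega>) {..<n1}"
  let ?V2 = "\<lambda>\<omega>. restrict (\<lambda>i. D i \<omega>) {n1..<n}"
  define W1 where "W1 = {v\<in>space ?P1. \<forall>u\<in>J. (\<Sum>j<i1 u. v j) \<in> B u}"
  define W2 where "W2 = {v\<in>space ?P2. \<forall>q\<in>K. (\<Sum>j<i2 q. v (n1 + j)) \<in> C q}"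
  have W1: "W1 \<in> sets ?P1"
    unfolding W1_def
  proof (intro sets.sets_Collect_finite_All J)
    fix u assume u: "u \<in> J"
    have "(\<lambda>v. \<Sum>j<i1 u. v j) \<in> borel_measurable ?P1"
      using i1[OF u] by (intro borel_measurable_sum measurable_component_singleton) auto
    then show "{v\<in>space ?P1. (\<Sum>j<i1 u. v j) \<in> B u} \<in> sets ?P1"
      using B[OF u] by measurable
  qed
  have W2: "W2 \<in> sets ?P2"
    unfolding W2_def
  proof (intro sets.sets_Collect_finite_All K)
    fix q assume q: "q \<in> K"
    have "(\<lambda>v. \<Sum>j<i2 q. v (n1 + j)) \<in> borel_measurable ?P2"
      using i2[OF q]
        by (intro borel_measurable_sum measurable_component_singleton) (auto simp: n_def)
    then show "{v\<in>space ?P2. (\<Sum>j<i2 q. v (n1 + j)) \<in> C q} \<in> sets ?P2"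
      using C[OF q] by measurable
  qed
  have tele1: "(\<Sum>j<i1 u. ?V1 \<omega> j) = X u \<omega> - X 0 \<omega>" if "u \<in> J" for u \<omega>
  proof -
    have "(\<Sum>j<i1 u. ?V1 \<omega> j) = (\<Sum>j<i1 u. X (t (Suc j)) \<omega> - X (t j) \<omega>)"
      using i1[OF that] by (intro sum.cong) (auto simp: D_def)
    also have "\<dots> = X u \<omega> - X 0 \<omega>"
      using i1[OF that] t_0 by (subst sum_lessThan_telescope) (auto simp: t_def)
    finally show ?thesis .
  qed
  have tele2: "(\<Sum>j<i2 q. ?V2 \<omega> (n1 + j)) = X (d + q) \<omega> - X d \<omega>" if "q \<in> K" for q \<omega>
  proof -
    have "(\<Sum>j<i2 q. ?V2 \<omega> (n1 + j)) = (\<Sum>j<i2 q. X (t (n1 + Suc j)) \<omega> - X (t (n1 + j)) \<omega>)"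
      using i2[OF that] by (intro sum.cong) (auto simp: D_def n_def)
    also have "\<dots> = X (d + q) \<omega> - X d \<omega>"
      using i2[OF that] t2(2) t_fut[of 0] by (subst sum_lessThan_telescope) (auto simp: t_fut)
    finally show ?thesis .
  qed
  have pre1: "?V1 -` W1 \<inter> space M = {\<omega>\<in>space M. \<forall>u\<in>J. X u \<omega> - X 0 \<omega> \<in> B u}"
    unfolding W1_def using tele1 by (auto simp: space_PiM)
  have pre2: "?V2 -` W2 \<inter> space M = {\<omega>\<in>space M. \<forall>q\<in>K. X (d + q) \<omega> - X d \<omega> \<in> C q}"
    unfolding W2_def using tele2 by (auto simp: space_PiM)
  have "(\<lambda>\<omega>. (?V1 \<omega>, ?V2 \<omega>)) -` (W1 \<times> W2) \<inter> space M =
     {\<omega>\<in>space M. (\<forall>u\<in>J. X u \<omega> - X 0 \<omega> \<in> B u) \<and> (\<forall>q\<in>K. X (d + q) \<omega> - X d \<omega> \<in> C q)}"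
    using pre1 pre2 by blast
  with indep_varD[OF ind W1 W2] show ?thesis
    using prob_future_cylinder[OF d K, of C] C unfolding pre1 pre2 by simp
qed

text \<open>
  The process restarted at time \<open>d\<close>, as a random element of a countable product space. For \<open>d = 0\<close>
  this is almost surely the process itself.
\<close>
definition restarted :: "real \<Rightarrow> 'a \<Rightarrow> real \<Rightarrow> real" where
  "restarted d \<omega> = (\<lambda>q\<in>rat_times. X (d + q) \<omega> - X d \<omega>)"

lemma restarted_measurable [measurable]:
  "0 \<le> d \<Longrightarrow> restarted d \<in> measurable M rat_paths"
  unfolding restarted_def
  by (intro measurable_restrict borel_measurable_diff random_variable_X) (auto simp: rat_times_def)

text \<open>
  A generator of the completed past of \<open>d\<close> that is stable under intersections. Allowing equality up
  to null sets takes care of the added null sets and of the fact that \<open>X 0 = 0\<close> holds only almost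
  surely.
\<close>
definition past_events :: "real \<Rightarrow> 'a set set" where
  "past_events d = {A\<in>sets (completion M). \<exists>J B. finite J \<and> J \<subseteq> {0..d} \<and> (\<forall>u\<in>J. B u \<in> sets borel) \<and>
     (AE \<omega> in M. \<omega> \<in> A \<longleftrightarrow> (\<forall>u\<in>J. X u \<omega> - X 0 \<omega> \<in> B u))}"

lemma Int_stable_past_events: "Int_stable (past_events d)"
proof (rule Int_stableI)
  fix A A' assume A: "A \<in> past_events d" "A' \<in> past_events d"
  obtain J B where J: "finite J" "J \<subseteq> {0..d}" "\<forall>u\<in>J. B u \<in> sets borel"
    "AE \<omega> in M. \<omega> \<in> A \<longleftrightarrow> (\<forall>u\<in>J. X u \<omega> - X 0 \<omega> \<in> B u)"
    using A unfolding past_events_def by blast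
  obtain J' B' where J': "finite J'" "J' \<subseteq> {0..d}" "\<forall>u\<in>J'. B' u \<in> sets borel"
    "AE \<omega> in M. \<omega> \<in> A' \<longleftrightarrow> (\<forall>u\<in>J'. X u \<omega> - X 0 \<omega> \<in> B' u)"
    using A unfolding past_events_def by blast
  define B'' where "B'' u = (if u \<in> J then B u else UNIV) \<inter> (if u \<in> J' then B' u else UNIV)" for u
  have "AE \<omega> in M. \<omega> \<in> A \<inter> A' \<longleftrightarrow> (\<forall>u\<in>J \<union> J'. X u \<omega> - X 0 \<omega> \<in> B'' u)"
    using J(4) J'(4) by eventually_elim (auto simp: B''_def)
  moreover have "\<forall>u\<in>J \<union> J'. B'' u \<in> sets borel"
    using J J' by (auto simp: B''_def)
  ultimately show "A \<inter> A' \<in> past_events d"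
    unfolding past_events_def using A J J'
    by (auto simp: past_events_def intro!: exI[of _ "J \<union> J'"] exI[of _ B''])
qed

lemma completed_filtration_subset_past_events:
  assumes d: "0 \<le> d"
  shows "sets (completed_filtration M X (ennreal d)) \<subseteq> sigma_sets (space M) (past_events d)"
proof -
  have "{X s -` B \<inter> space M | s B. 0 \<le> s \<and> ennreal s \<le> ennreal d \<and> B \<in> sets borel} \<subseteq> past_events d"
  proof safe
    fix s and B :: "real set" assume s: "0 \<le> s" "ennreal s \<le> ennreal d" and B: "B \<in> sets borel"
    have "AE \<omega> in M. \<omega> \<in> X s -` B \<inter> space M \<longleftrightarrow> (\<forall>u\<in>{s}. X u \<omega> - X 0 \<omega> \<in> B)"
      using start_zero AE_space by eventually_elim auto
    moreover have "X s -` B \<inter> space M \<in> sets M"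
      using random_variable_X[OF s(1)] B by (rule measurable_sets)
    ultimately show "X s -` B \<inter> space M \<in> past_events d"
      unfolding past_events_def using s B d
      by (intro CollectI conjI exI[of _ "{s}"] exI[of _ "\<lambda>_. B"]) auto
  qed
  moreover have "null_sets (completion M) \<subseteq> past_events d"
  proof
    fix A assume A: "A \<in> null_sets (completion M)"
    then have "AE \<omega> in completion M. \<omega> \<notin> A" by (rule AE_not_in)
    then have "AE \<omega> in M. \<omega> \<in> A \<longleftrightarrow> (\<forall>u\<in>{0}. X u \<omega> - X 0 \<omega> \<in> {})"
      unfolding AE_completion_iff by eventually_elim auto
    then show "A \<in> past_events d"
      unfolding past_events_def using A d
      by (intro CollectI conjI exI[of _ "{0}"] exI[of _ "\<lambda>_. {}"]) auto
  qed
  ultimately show ?thesis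
    unfolding completed_filtration_def
    by (subst sets_measure_of[OF completed_filtration_gen_subset]) (auto intro!: sigma_sets_mono')
qed

text \<open>
  For a fixed event \<open>A\<close> both sides are finite measures in \<open>C\<close>; by the factorisation of cylinders they
  agree on the finite-dimensional cylinders, which determine a measure on the path space.
\<close>
lemma past_events_indep_restarted:
  assumes d: "0 \<le> d" and A: "A \<in> past_events d" and C: "C \<in> sets rat_paths"
  shows "measure (completion M) (A \<inter> (restarted d -` C \<inter> space M)) =
    measure (completion M) A * prob (restarted 0 -` C \<inter> space M)"
proof -
  interpret N: prob_space "completion M" by (rule prob_space_completion)
  have [measurable]: "A \<in> sets (completion M)" using A by (simp add: past_events_def)
  have [measurable]: "restarted d \<in> measurable (completion M) rat_paths"
    "restarted 0 \<in> measurable M rat_paths"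
    using d by (auto intro: measurable_completion)
  obtain J B where J: "finite J" "J \<subseteq> {0..d}" "\<And>u. u \<in> J \<Longrightarrow> B u \<in> sets borel"
    and ae: "AE \<omega> in M. \<omega> \<in> A \<longleftrightarrow> (\<forall>u\<in>J. X u \<omega> - X 0 \<omega> \<in> B u)"
    using A unfolding past_events_def by blast
  have [measurable]: "X u \<in> borel_measurable M" if "u \<in> J" for u
    using J that by (auto intro!: random_variable_X)
  have [measurable]: "X 0 \<in> borel_measurable M" "X d \<in> borel_measurable M"
    using d by (auto intro!: random_variable_X)
  define P where "P = distr (density (completion M) (indicator A)) rat_paths (restarted d)"
  define Q where "Q = scale_measure (emeasure (completion M) A) (distr M rat_paths (restarted 0))"
  have P: "emeasure P C = emeasure (completion M) (A \<inter> (restarted d -` C \<inter> space M))"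
    if "C \<in> sets rat_paths" for C
  proof -
    have "restarted d -` C \<inter> space M \<in> sets (completion M)"
      using measurable_sets[OF \<open>restarted d \<in> measurable (completion M) rat_paths\<close> that] by simp
    then show ?thesis
      unfolding P_def using that
      by (subst emeasure_distr)
        (auto simp: emeasure_density nn_integral_indicator indicator_inter_arith[symmetric] simp del: emeasure_completion)
  qed
  have Q: "emeasure Q C = emeasure (completion M) A * emeasure M (restarted 0 -` C \<inter> space M)"
    if "C \<in> sets rat_paths" for C
    unfolding Q_def using that by (simp add: emeasure_distr)
  have "P = Q"
  proof (rule measure_eqI_PiM_infinite)
    show "sets P = sets rat_paths" "sets Q = sets rat_paths" by (simp_all add: P_def Q_def)
    show "finite_measure P"
    proof
      have "emeasure P (space P) \<le> 1"
        using P[of "space rat_paths"] N.emeasure_le_1 by (simp add: P_def)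
      then show "emeasure P (space P) \<noteq> \<infinity>" by (auto simp: top_unique)
    qed
    fix C :: "real \<Rightarrow> real set" and K :: "real set" assume K: "finite K" "K \<subseteq> rat_times"
      and C: "\<And>i. i \<in> K \<Longrightarrow> C i \<in> sets borel"
    let ?E = "prod_emb rat_times (\<lambda>_. borel) K (Pi\<^sub>E K C)"
    have E: "?E \<in> sets rat_paths" using K C by (intro sets_PiM_I) auto
    have [measurable]: "X (d + q) \<in> borel_measurable M" "X q \<in> borel_measurable M" if "q \<in> K" for q
      using K that d rat_times_nonneg[of q] by (auto intro!: random_variable_X)
    have pre: "restarted c -` ?E \<inter> space M = {\<omega>\<in>space M. \<forall>q\<in>K. X (c + q) \<omega> - X c \<omega> \<in> C q}" for c
      using K by (auto simp: restarted_def prod_emb_def Int_absorb1 subset_iff)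
    have K0: "K \<subseteq> {0..}" using K rat_times_nonneg by auto
    have mJ: "{\<omega>\<in>space M. \<forall>u\<in>J. X u \<omega> - X 0 \<omega> \<in> B u} \<in> sets M"
      using J by (intro sets.sets_Collect_finite_All) auto
    have mK: "{\<omega>\<in>space M. \<forall>q\<in>K. X (d + q) \<omega> - X d \<omega> \<in> C q} \<in> sets M"
      using K C by (intro sets.sets_Collect_finite_All) auto
    have mJK: "{\<omega>\<in>space M. (\<forall>u\<in>J. X u \<omega> - X 0 \<omega> \<in> B u) \<and> (\<forall>q\<in>K. X (d + q) \<omega> - X d \<omega> \<in> C q)} \<in> sets M"
      using sets.Int[OF mJ mK] by (auto simp: Int_def conj_ac elim: back_subst[of "\<lambda>S. S \<in> sets M"])
    have "measure (completion M) (A \<inter> (restarted d -` ?E \<inter> space M)) =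
      prob {\<omega>\<in>space M. (\<forall>u\<in>J. X u \<omega> - X 0 \<omega> \<in> B u) \<and> (\<forall>q\<in>K. X (d + q) \<omega> - X d \<omega> \<in> C q)}"
      unfolding measure_completion[OF mJK, symmetric] pre
      using ae mK mJK by (intro measure_eq_AE) (auto simp: AE_completion_iff)
    moreover have "measure (completion M) A = prob {\<omega>\<in>space M. \<forall>u\<in>J. X u \<omega> - X 0 \<omega> \<in> B u}"
      unfolding measure_completion[OF mJ, symmetric]
    proof (intro measure_eq_AE)
      show "AE \<omega> in completion M. (\<omega> \<in> A) = (\<omega> \<in> {\<omega>\<in>space M. \<forall>u\<in>J. X u \<omega> - X 0 \<omega> \<in> B u})"
        unfolding AE_completion_iff using ae AE_space by eventually_elim auto
    qed (use mJ in auto)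
    ultimately have "measure (completion M) (A \<inter> (restarted d -` ?E \<inter> space M)) =
        measure (completion M) A * prob (restarted 0 -` ?E \<inter> space M)"
      using prob_past_future_cylinder[OF d J K(1) K0 C] unfolding pre by simp
    then show "emeasure P ?E = emeasure Q ?E"
      unfolding P[OF E] Q[OF E] N.emeasure_eq_measure emeasure_eq_measure
      by (simp add: ennreal_mult'')
  qed
  then have "emeasure (completion M) (A \<inter> (restarted d -` C \<inter> space M)) =
      emeasure (completion M) A * emeasure M (restarted 0 -` C \<inter> space M)"
    using P[OF C] Q[OF C] by simp
  then show ?thesis
    unfolding N.emeasure_eq_measure emeasure_eq_measure
    by (simp add: ennreal_mult''[symmetric])
qed

lemma completed_filtration_completion:
  assumes d: "0 \<le> d" and A: "A \<in> sets (completed_filtration M X (ennreal d))"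
  shows "A \<in> sets (completion M)"
proof -
  have "sigma_sets (space (completion M)) (past_events d) \<subseteq> sets (completion M)"
    by (rule sets.sigma_sets_subset) (auto simp: past_events_def)
  then show ?thesis
    using completed_filtration_subset_past_events[OF d] A by auto
qed

text \<open>
  Independence extends from the generator \<open>past_events\<close> to the generated \<open>\<sigma>\<close>-algebra.
  The law of the future is the case of the factorisation where \<open>A\<close> is the whole space.
\<close>
lemma completed_filtration_indep_restarted:
  assumes d: "0 \<le> d" and A: "A \<in> sets (completed_filtration M X (ennreal d))"
    and C: "C \<in> sets rat_paths"
  shows "measure (completion M) (A \<inter> (restarted d -` C \<inter> space M)) =
    measure (completion M) A * prob (restarted 0 -` C \<inter> space M)"
proof -
  interpret N: prob_space "completion M" by (rule prob_space_completion)
  let ?F = "{restarted d -` C \<inter> space M | C. C \<in> sets rat_paths}"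
  have m: "restarted d \<in> measurable (completion M) rat_paths"
    using d by (auto intro: measurable_completion)
  have sp: "space M \<in> past_events d"
    unfolding past_events_def using d AE_space
    by (intro CollectI conjI exI[of _ "{}"] exI[of _ "\<lambda>_. {}"]) auto
  have fut: "measure (completion M) (restarted d -` C \<inter> space M) = prob (restarted 0 -` C \<inter> space M)"
    if "C \<in> sets rat_paths" for C
    using past_events_indep_restarted[OF d sp that] N.prob_space
      by (simp add: Int_absorb1 space_completion)
  have "N.indep_set (past_events d) ?F"
  proof (rule N.indep_setI)
    show "past_events d \<subseteq> N.events" by (auto simp: past_events_def)
    show "?F \<subseteq> N.events" using measurable_sets[OF m] by auto
  qed (use past_events_indep_restarted[OF d] fut in auto)
  moreover have "Int_stable ?F"
  proof (rule Int_stableI)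
    fix a b assume "a \<in> ?F" "b \<in> ?F"
    then obtain C D where "a = restarted d -` C \<inter> space M" "b = restarted d -` D \<inter> space M"
      "C \<in> sets rat_paths"
      "D \<in> sets rat_paths"
      by auto
    then show "a \<inter> b \<in> ?F" by (intro CollectI exI[of _ "C \<inter> D"]) auto
  qed
  ultimately have ind: "N.indep_set (sigma_sets (space M) (past_events d)) (sigma_sets (space M) ?F)"
    using N.indep_set_sigma_sets[OF _ Int_stable_past_events] by simp
  have A': "A \<in> sigma_sets (space M) (past_events d)"
    using completed_filtration_subset_past_events[OF d] A by auto
  show "measure (completion M) (A \<inter> (restarted d -` C \<inter> space M)) =
    measure (completion M) A * prob (restarted 0 -` C \<inter> space M)"
    using N.indep_setD[OF ind A', of "restarted d -` C \<inter> space M"] C fut[OF C]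
      by (auto intro: sigma_sets.Basic)
qed

text \<open>
  Restricted to \<open>A\<close>, the law of the restarted process is \<open>P(A)\<close> times the law of the process itself.
\<close>
lemma markov_property:
  assumes d: "0 \<le> d" and A: "A \<in> sets (completed_filtration M X (ennreal d))"
    and G: "G \<in> borel_measurable rat_paths"
  shows "(\<integral>\<^sup>+\<omega>. indicator A \<omega> * G (restarted d \<omega>) \<partial>completion M) =
    emeasure (completion M) A * (\<integral>\<^sup>+\<omega>. G (restarted 0 \<omega>) \<partial>M)"
proof -
  interpret N: prob_space "completion M" by (rule prob_space_completion)
  have [measurable]: "A \<in> sets (completion M)" using completed_filtration_completion[OF d A] by auto
  have [measurable]: "restarted d \<in> measurable (completion M) rat_paths"
    "restarted 0 \<in> measurable M rat_paths"
    using d by (auto intro: measurable_completion)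
  note G[measurable]
  have "distr (density (completion M) (indicator A)) rat_paths (restarted d) =
      scale_measure (emeasure (completion M) A) (distr M rat_paths (restarted 0))" (is "?P = ?Q")
  proof (rule measure_eqI)
    fix C assume "C \<in> sets ?P"
    then have C: "C \<in> sets rat_paths" by simp
    have "restarted d -` C \<inter> space M \<in> sets (completion M)"
      using measurable_sets[OF \<open>restarted d \<in> measurable (completion M) rat_paths\<close> C] by simp
    then have "emeasure ?P C = emeasure (completion M) (A \<inter> (restarted d -` C \<inter> space M))"
      using C by (subst emeasure_distr)
        (auto simp: emeasure_density indicator_inter_arith[symmetric] simp del: emeasure_completion)
    also have "\<dots> = emeasure ?Q C"
      using completed_filtration_indep_restarted[OF d A C] C
      by (simp add: N.emeasure_eq_measure emeasure_eq_measure emeasure_distr ennreal_mult'')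
    finally show "emeasure ?P C = emeasure ?Q C" .
  qed simp
  then have "(\<integral>\<^sup>+f. G f \<partial>?P) = (\<integral>\<^sup>+f. G f \<partial>?Q)" by simp
  then show ?thesis
    by (simp add: nn_integral_distr nn_integral_density nn_integral_scale_measure)
qed

section \<open>The remaining time to the supremum\<close>

lemma time_of_sup_AE_eq:
  "AE \<omega> in M. time_of_sup X \<omega> = last_overtaken rat_times (restarted 0 \<omega>)"
  using cadlag_paths start_zero
proof eventually_elim
  case (elim \<omega>)
  have "time_of_sup X \<omega> = last_overtaken rat_times (\<lambda>t. X t \<omega>)"
    unfolding time_of_sup_eq_last_overtaken
    using elim by (intro last_overtaken_rat_times) (auto simp: cadlag_def)
  also have "\<dots> = last_overtaken rat_times (restarted 0 \<omega>)"
    using elim by (intro last_overtaken_cong) (auto simp: restarted_def)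
  finally show ?case .
qed

text \<open>
  The expectation \<open>m y = E[\<theta>; sup X > y]\<close>, written with measurable functions of the path on
  rational times.
\<close>
definition mean_time_if_above :: "real \<Rightarrow> ennreal" where
  "mean_time_if_above y = (\<integral>\<^sup>+\<omega>. last_overtaken rat_times (restarted 0 \<omega>) * indicator (rises_above y) (restarted 0 \<omega>) \<partial>M)"

lemma last_overtaken_restarted_le:
  assumes c: "cadlag (\<lambda>t. X t \<omega>)" and d: "0 \<le> d"
    and le: "\<And>u. 0 \<le> u \<Longrightarrow> u \<le> d \<Longrightarrow> X u \<omega> \<le> X d \<omega> + \<epsilon>"
  shows "last_overtaken rat_times (restarted d \<omega>) * indicator (rises_above \<epsilon>) (restarted d \<omega>) \<le>
    time_of_sup X \<omega> - ennreal d"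
proof (cases "restarted d \<omega> \<in> rises_above \<epsilon>")
  case True
  then obtain q where q: "q \<in> rat_times" "\<epsilon> < restarted d \<omega> q"
    by (auto simp: rises_above_def)
  have "last_overtaken rat_times (restarted d \<omega>) = last_overtaken rat_times (\<lambda>t. X (d + t) \<omega> - X d \<omega>)"
    by (intro last_overtaken_cong) (simp add: restarted_def)
  also have "\<dots> = last_overtaken {0..} (\<lambda>t. X (d + t) \<omega> - X d \<omega>)"
    using right_continuous_shift[OF c d] by (intro last_overtaken_rat_times[symmetric])
  also have "\<dots> \<le> time_of_sup X \<omega> - ennreal d"
    unfolding time_of_sup_eq_last_overtaken
    using q rat_times_nonneg[of q]
    by (intro last_overtaken_shift_le[where f = "\<lambda>t. X t \<omega>"
      and \<epsilon> = \<epsilon> and q = q] d le) (auto simp: restarted_def)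
  finally show ?thesis using True by simp
qed simp

text \<open>
  The lower bound \<open>E[(\<theta> - d)\<^sup>+; A] \<ge> P(A) * m \<epsilon>\<close>: the pathwise bound for \<open>\<theta> - d\<close> is integrated over \<open>A\<close>.
  The bound is a function of the restarted process and hence independent of \<open>A\<close>.
\<close>
lemma mean_time_if_above_le_remaining_time:
  assumes d: "0 \<le> d" and A: "A \<in> sets (completed_filtration M X (ennreal d))"
    and le: "AE \<omega> in M. \<omega> \<in> A \<longrightarrow> (\<forall>u. 0 \<le> u \<longrightarrow> u \<le> d \<longrightarrow> X u \<omega> \<le> X d \<omega> + \<epsilon>)"
  shows "emeasure (completion M) A * mean_time_if_above \<epsilon> \<le>
    (\<integral>\<^sup>+\<omega>. indicator A \<omega> * (time_of_sup X \<omega> - ennreal d) \<partial>M)"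
proof -
  let ?G = "\<lambda>f. last_overtaken rat_times f * indicator (rises_above \<epsilon>) f"
  have "?G \<in> borel_measurable rat_paths" by measurable
  then have "emeasure (completion M) A * mean_time_if_above \<epsilon> =
      (\<integral>\<^sup>+\<omega>. indicator A \<omega> * ?G (restarted d \<omega>) \<partial>completion M)"
    unfolding mean_time_if_above_def by (rule markov_property[OF d A, symmetric])
  also have "\<dots> \<le> (\<integral>\<^sup>+\<omega>. indicator A \<omega> * (time_of_sup X \<omega> - ennreal d) \<partial>completion M)"
  proof (rule nn_integral_mono_AE)
    show "AE \<omega> in completion M. indicator A \<omega> * ?G (restarted d \<omega>) \<le> indicator A \<omega> * (time_of_sup X \<omega> - ennreal d)"
      unfolding AE_completion_iff using le cadlag_paths
    proof eventually_elim
      case (elim \<omega>)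
      show ?case
      proof (cases "\<omega> \<in> A")
        case True
        then have "?G (restarted d \<omega>) \<le> time_of_sup X \<omega> - ennreal d"
          using elim by (intro last_overtaken_restarted_le d) auto
        then show ?thesis using True by simp
      qed simp
    qed
  qed
  finally show ?thesis by (simp only: nn_integral_completion)
qed

lemma completed_filtration_X:
  assumes "0 \<le> u" "u \<le> d"
  shows "X u \<in> borel_measurable (completed_filtration M X (ennreal d))"
proof (rule measurableI)
  fix B :: "real set" assume "B \<in> sets borel"
  then have "X u -` B \<inter> space M \<in> {X s -` B \<inter> space M | s B. 0 \<le> s \<and> ennreal s \<le> ennreal d \<and> B \<in> sets borel} \<union>
      null_sets (completion M)"
    using assms by (auto intro!: ennreal_leI)
  then show "X u -` B \<inter> space (completed_filtration M X (ennreal d)) \<in> sets (completed_filtration M X (ennreal d))"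
    unfolding completed_filtration_def
    by (subst sets_measure_of[OF completed_filtration_gen_subset])
       (auto simp: space_measure_of[OF completed_filtration_gen_subset] simp del: Un_iff intro: sigma_sets.Basic)
qed simp

lemma near_maximum_event:
  assumes d: "d \<in> rat_times"
  shows "{\<omega>\<in>space M. \<forall>u\<in>{u\<in>rat_times. u \<le> d}. X u \<omega> \<le> X d \<omega> + \<epsilon>} \<in> sets (completed_filtration M X (ennreal d))"
proof -
  have "Measurable.pred (completed_filtration M X (ennreal d)) (\<lambda>\<omega>. \<forall>u\<in>{u\<in>rat_times. u \<le> d}. X u \<omega> \<le> X d \<omega> + \<epsilon>)"
  proof (intro measurable_pred_countable)
    fix u assume "u \<in> {u\<in>rat_times. u \<le> d}"
    then show "Measurable.pred (completed_filtration M X (ennreal d)) (\<lambda>\<omega>. X u \<omega> \<le> X d \<omega> + \<epsilon>)"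
      unfolding pred_def using rat_times_nonneg[OF d] rat_times_nonneg[of u]
      by (intro borel_measurable_le borel_measurable_add borel_measurable_const completed_filtration_X) auto
  qed (auto intro: countable_subset[OF _ countable_rat_times])
  then show ?thesis by (simp add: pred_def)
qed

lemma near_maximum_AE:
  assumes d: "d \<in> rat_times"
  shows "AE \<omega> in M. (\<forall>u\<in>{u\<in>rat_times. u \<le> d}. X u \<omega> \<le> X d \<omega> + \<epsilon>) \<longrightarrow>
    (\<forall>u. 0 \<le> u \<longrightarrow> u \<le> d \<longrightarrow> X u \<omega> \<le> X d \<omega> + \<epsilon>)"
  using cadlag_paths
proof eventually_elim
  case (elim \<omega>)
  then show ?case
    using right_continuous_le_on_rats[of "\<lambda>t. X t \<omega>" d "X d \<omega> + \<epsilon>"] d by (auto simp: cadlag_def)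
qed

section \<open>Infinite mean on every event of rising above a level\<close>

text \<open>
  The substitute for the strong Markov property at the first passage above \<open>y\<close>. On the event \<open>A n i\<close>
  the first point of the grid of mesh \<open>1 / (n + 1)\<close> with value above \<open>y\<close> is the \<open>i\<close>-th one, and the
  path is there within \<open>\<epsilon>\<close> of its past maximum. These events are disjoint, belong to the past of
  the grid point, and imply that the path rises above \<open>y\<close>; summing the lower bounds for the remaining
  time gives \<open>P(B n) * m \<epsilon> \<le> m y\<close> for their union \<open>B n\<close>. A path that rises above \<open>y\<close> belongs to \<open>B n\<close>
  for all large \<open>n\<close>, so that Fatou's lemma concludes.
\<close>
lemma mean_time_if_above_recursion:
  assumes eps: "0 < \<epsilon>"
  shows "emeasure M {\<omega>\<in>space M. restarted 0 \<omega> \<in> rises_above y} * mean_time_if_above \<epsilon> \<le> mean_time_if_above y"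
proof -
  interpret N: prob_space "completion M" by (rule prob_space_completion)
  define g where "g n i = real i / real (Suc n)" for n i
  have g: "g n i \<in> rat_times" for n i by (auto simp: g_def rat_times_def)
  have g0: "0 \<le> g n i" for n i using rat_times_nonneg[OF g] .
  have g_mono: "j \<le> i \<Longrightarrow> g n j \<le> g n i" for n i j unfolding g_def by (intro divide_right_mono) auto
  define near where "near n i = {\<omega>\<in>space M. \<forall>u\<in>{u\<in>rat_times. u \<le> g n i}. X u \<omega> \<le> X (g n i) \<omega> + \<epsilon>}" for n i
  define A where "A n i = {\<omega>\<in>space M. y < X (g n i) \<omega> \<and> (\<forall>j\<in>{..<i}. X (g n j) \<omega> \<le> y)} \<inter> near n i" for n i
  define B where "B n = (\<Union>i. A n i)" for n
  have A_F: "A n i \<in> sets (completed_filtration M X (ennreal (g n i)))" for n i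
  proof -
    have "{\<omega>\<in>space (completed_filtration M X (ennreal (g n i))). y < X (g n i) \<omega> \<and> (\<forall>j\<in>{..<i}. X (g n j) \<omega> \<le> y)}
       \<in> sets (completed_filtration M X (ennreal (g n i)))"
      using g0 g_mono
      by (intro sets.sets_Collect_conj sets.sets_Collect_finite_All borel_measurable_less borel_measurable_le
          borel_measurable_const completed_filtration_X) auto
    then show ?thesis
      unfolding A_def near_def using near_maximum_event[OF g, of n i \<epsilon>] by (intro sets.Int) simp_all
  qed
  have A_N [measurable]: "A n i \<in> sets (completion M)" for n i
    using completed_filtration_completion[OF g0 A_F] by auto
  have B_N [measurable]: "B n \<in> sets (completion M)" for n by (auto simp: B_def)
  have disj: "disjoint_family (A n)" for n
  proof -
    have "A n i \<inter> A n j = {}" if "i < j" for i j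
      using that by (auto simp: A_def dest!: bspec[where x = i])
    then show ?thesis
      unfolding disjoint_family_on_def by (metis Int_commute nat_neq_iff)
  qed
  let ?\<theta> = "\<lambda>\<omega>. last_overtaken rat_times (restarted 0 \<omega>)"
  have [measurable]: "restarted 0 \<in> measurable M rat_paths" by (rule restarted_measurable) simp
  have \<theta>[measurable]: "?\<theta> \<in> borel_measurable (completion M)"
    by (intro measurable_completion) measurable
  have A_bound: "emeasure (completion M) (A n i) * mean_time_if_above \<epsilon> \<le> (\<integral>\<^sup>+\<omega>. indicator (A n i) \<omega> * ?\<theta> \<omega> \<partial>completion M)" for n i
  proof -
    have "AE \<omega> in M. \<omega> \<in> A n i \<longrightarrow> (\<forall>u. 0 \<le> u \<longrightarrow> u \<le> g n i \<longrightarrow> X u \<omega> \<le> X (g n i) \<omega> + \<epsilon>)"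
      using near_maximum_AE[OF g, of n i \<epsilon>] by eventually_elim (auto simp: A_def near_def)
    then have "emeasure (completion M) (A n i) * mean_time_if_above \<epsilon> \<le>
        (\<integral>\<^sup>+\<omega>. indicator (A n i) \<omega> * (time_of_sup X \<omega> - ennreal (g n i)) \<partial>M)"
      by (rule mean_time_if_above_le_remaining_time[OF g0 A_F])
    also have "\<dots> \<le> (\<integral>\<^sup>+\<omega>. indicator (A n i) \<omega> * ?\<theta> \<omega> \<partial>M)"
    proof (rule nn_integral_mono_AE)
      show "AE \<omega> in M. indicator (A n i) \<omega> * (time_of_sup X \<omega> - ennreal (g n i)) \<le> indicator (A n i) \<omega> * ?\<theta> \<omega>"
        using time_of_sup_AE_eq by eventually_elim
          (auto intro!: mult_left_mono diff_le_self_ennreal)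
    qed
    finally show ?thesis by (simp only: nn_integral_completion)
  qed
  have B_bound: "emeasure (completion M) (B n) * mean_time_if_above \<epsilon> \<le> mean_time_if_above y" for n
  proof -
    have "emeasure (completion M) (B n) * mean_time_if_above \<epsilon> = (\<Sum>i. emeasure (completion M) (A n i)) * mean_time_if_above \<epsilon>"
      unfolding B_def using disj by (subst suminf_emeasure) auto
    also have "\<dots> = (\<Sum>i. emeasure (completion M) (A n i) * mean_time_if_above \<epsilon>)"
      by (rule ennreal_suminf_multc[symmetric])
    also have "\<dots> \<le> (\<Sum>i. \<integral>\<^sup>+\<omega>. indicator (A n i) \<omega> * ?\<theta> \<omega> \<partial>completion M)"
      by (intro suminf_le A_bound) auto
    also have "\<dots> = (\<integral>\<^sup>+\<omega>. (\<Sum>i. indicator (A n i) \<omega> * ?\<theta> \<omega>) \<partial>completion M)"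
      by (rule nn_integral_suminf[symmetric]) measurable
    also have "\<dots> = (\<integral>\<^sup>+\<omega>. indicator (B n) \<omega> * ?\<theta> \<omega> \<partial>completion M)"
      unfolding B_def ennreal_suminf_multc suminf_indicator[OF disj] ..
    also have "\<dots> \<le> (\<integral>\<^sup>+\<omega>. ?\<theta> \<omega> * indicator (rises_above y) (restarted 0 \<omega>) \<partial>completion M)"
    proof (rule nn_integral_mono_AE)
      show "AE \<omega> in completion M. indicator (B n) \<omega> * ?\<theta> \<omega> \<le> ?\<theta> \<omega> * indicator (rises_above y) (restarted 0 \<omega>)"
        unfolding AE_completion_iff using start_zero
      proof eventually_elim
        case (elim \<omega>)
        have "restarted 0 \<omega> \<in> rises_above y" if "\<omega> \<in> B n"
          using that g elim by (auto simp: B_def A_def rises_above_def restarted_def)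
        then show ?case by (auto simp: indicator_def)
      qed
    qed
    also have "\<dots> = mean_time_if_above y" unfolding mean_time_if_above_def
      by (rule nn_integral_completion)
    finally show ?thesis .
  qed
  have ev: "AE \<omega> in M. restarted 0 \<omega> \<in> rises_above y \<longrightarrow> (\<forall>\<^sub>F n in sequentially. \<omega> \<in> B n)"
    using cadlag_paths start_zero AE_space
  proof eventually_elim
    case (elim \<omega>)
    show ?case
    proof
      assume "restarted 0 \<omega> \<in> rises_above y"
      then obtain q where q: "q \<in> rat_times" "y < X q \<omega>"
        using elim by (auto simp: rises_above_def restarted_def)
      have "\<forall>\<^sub>F n in sequentially. \<exists>i. y < X (g n i) \<omega> \<and> (\<forall>j<i. X (g n j) \<omega> \<le> y) \<and>
         (\<forall>u. 0 \<le> u \<longrightarrow> u \<le> g n i \<longrightarrow> X u \<omega> \<le> X (g n i) \<omega> + \<epsilon>)"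
        unfolding g_def
        using elim q rat_times_nonneg[OF q(1)] eps
        by (intro eventually_grid_exceeds[of "\<lambda>t. X t \<omega>" q]) (auto simp: cadlag_def)
      then show "\<forall>\<^sub>F n in sequentially. \<omega> \<in> B n"
      proof eventually_elim
        fix n
        assume "\<exists>i. y < X (g n i) \<omega> \<and> (\<forall>j<i. X (g n j) \<omega> \<le> y) \<and>
         (\<forall>u. 0 \<le> u \<longrightarrow> u \<le> g n i \<longrightarrow> X u \<omega> \<le> X (g n i) \<omega> + \<epsilon>)"
        then obtain i where "y < X (g n i) \<omega>" "\<forall>j<i. X (g n j) \<omega> \<le> y"
          "\<forall>u. 0 \<le> u \<longrightarrow> u \<le> g n i \<longrightarrow> X u \<omega> \<le> X (g n i) \<omega> + \<epsilon>" by auto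
        then have "\<omega> \<in> A n i"
          using elim rat_times_nonneg by (auto simp: A_def near_def)
        then show "\<omega> \<in> B n" by (auto simp: B_def)
      qed
    qed
  qed
  have "emeasure M {\<omega>\<in>space M. restarted 0 \<omega> \<in> rises_above y} * mean_time_if_above \<epsilon> =
      (\<integral>\<^sup>+\<omega>. indicator {\<omega>\<in>space M. restarted 0 \<omega> \<in> rises_above y} \<omega> * mean_time_if_above \<epsilon> \<partial>M)"
    by (subst nn_integral_multc) (auto simp: pred_def[symmetric])
  also have "\<dots> \<le> (\<integral>\<^sup>+\<omega>. liminf (\<lambda>n. indicator (B n) \<omega> * mean_time_if_above \<epsilon>) \<partial>M)"
  proof (rule nn_integral_mono_AE)
    show "AE \<omega> in M. indicator {\<omega>\<in>space M. restarted 0 \<omega> \<in> rises_above y} \<omega> * mean_time_if_above \<epsilon> \<le>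
        liminf (\<lambda>n. indicator (B n) \<omega> * mean_time_if_above \<epsilon>)"
      using ev
    proof eventually_elim
      case (elim \<omega>)
      show ?case
      proof (cases "restarted 0 \<omega> \<in> rises_above y")
        case True
        with elim have "\<forall>\<^sub>F n in sequentially. mean_time_if_above \<epsilon> \<le> indicator (B n) \<omega> * mean_time_if_above \<epsilon>"
          by (auto elim!: eventually_mono)
        then have "mean_time_if_above \<epsilon> \<le> liminf (\<lambda>n. indicator (B n) \<omega> * mean_time_if_above \<epsilon>)"
          by (rule Liminf_bounded)
        then show ?thesis by (auto simp: indicator_def)
      qed simp
    qed
  qed
  also have "\<dots> = (\<integral>\<^sup>+\<omega>. liminf (\<lambda>n. indicator (B n) \<omega> * mean_time_if_above \<epsilon>) \<partial>completion M)"
    by (rule nn_integral_completion[symmetric])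
  also have "\<dots> \<le> liminf (\<lambda>n. \<integral>\<^sup>+\<omega>. indicator (B n) \<omega> * mean_time_if_above \<epsilon> \<partial>completion M)"
    by (intro nn_integral_liminf) measurable
  also have "\<dots> = liminf (\<lambda>n. emeasure (completion M) (B n) * mean_time_if_above \<epsilon>)"
    by (simp add: nn_integral_multc del: emeasure_completion)
  also have "\<dots> \<le> liminf (\<lambda>n. mean_time_if_above y)"
    by (intro Liminf_mono always_eventually allI B_bound)
  also have "\<dots> = mean_time_if_above y" by (simp add: Liminf_const)
  finally show ?thesis .
qed

lemma rises_above_event [measurable]: "{\<omega>\<in>space M. restarted 0 \<omega> \<in> rises_above y} \<in> sets M"
proof -
  have [measurable]: "restarted 0 \<in> measurable M rat_paths" by (rule restarted_measurable) simp
  show ?thesis by measurable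
qed

text \<open>
  Monotone convergence, since a path with a positive time of the supremum rises above its initial
  value 0.
\<close>
lemma SUP_mean_time_if_above:
  "(SUP k. mean_time_if_above (1 / real (Suc k))) = (\<integral>\<^sup>+\<omega>. time_of_sup X \<omega> \<partial>M)"
proof -
  have [measurable]: "restarted 0 \<in> measurable M rat_paths" by (rule restarted_measurable) simp
  let ?G = "\<lambda>k \<omega>. last_overtaken rat_times (restarted 0 \<omega>) * indicator (rises_above (1 / real (Suc k))) (restarted 0 \<omega>)"
  have sub: "rises_above (1 / real (Suc k)) \<subseteq> rises_above (1 / real (Suc l))" if "k \<le> l" for k l
  proof -
    have "1 / real (Suc l) \<le> 1 / real (Suc k)" using that by (intro divide_left_mono) auto
    then show ?thesis unfolding rises_above_def by force
  qed
  have "(SUP k. mean_time_if_above (1 / real (Suc k))) = (\<integral>\<^sup>+\<omega>. (SUP k. ?G k \<omega>) \<partial>M)"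
    unfolding mean_time_if_above_def
  proof (rule nn_integral_monotone_convergence_SUP[symmetric])
    show "incseq ?G"
      using sub by (auto simp: incseq_def le_fun_def indicator_def)
  qed measurable
  also have "\<dots> = (\<integral>\<^sup>+\<omega>. time_of_sup X \<omega> \<partial>M)"
  proof (rule nn_integral_cong_AE)
    show "AE \<omega> in M. (SUP k. ?G k \<omega>) = time_of_sup X \<omega>"
      using time_of_sup_AE_eq
    proof eventually_elim
      case (elim \<omega>)
      have "(SUP k. ?G k \<omega>) = last_overtaken rat_times (restarted 0 \<omega>)"
      proof (cases "\<exists>q\<in>rat_times. 0 < restarted 0 \<omega> q")
        case True
        then obtain q where q: "q \<in> rat_times" "0 < restarted 0 \<omega> q" by auto
        then obtain k where "1 / real (Suc k) < restarted 0 \<omega> q" using nat_approx_posE by blast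
        then have "restarted 0 \<omega> \<in> rises_above (1 / real (Suc k))"
          using q by (auto simp: rises_above_def)
        then have "?G k \<omega> = last_overtaken rat_times (restarted 0 \<omega>)"
          by (simp del: of_nat_Suc)
        then show ?thesis
          by (intro antisym SUP_least SUP_upper2[of k]) (auto simp: indicator_def)
      next
        case False
        then have "last_overtaken rat_times (restarted 0 \<omega>) = 0"
          by (intro last_overtaken_eq_0) (auto simp: restarted_def not_less)
        then show ?thesis by simp
      qed
      with elim show ?case by simp
    qed
  qed
  finally show ?thesis .
qed

text \<open>
  If \<open>\<theta>\<close> is not almost surely 0, the path rises above some \<open>\<delta> > 0\<close> with positive probability, hence
  does so at some fixed rational time \<open>q\<close>. With positive probability \<open>n\<close> consecutive increments over
  intervals of length \<open>q\<close> all exceed \<open>\<delta>\<close>, and then the path exceeds \<open>n * \<delta>\<close>.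
\<close>
lemma rises_above_positive:
  assumes pos: "(\<integral>\<^sup>+\<omega>. time_of_sup X \<omega> \<partial>M) \<noteq> 0"
  shows "0 < emeasure M {\<omega>\<in>space M. restarted 0 \<omega> \<in> rises_above y}"
proof -
  have [measurable]: "restarted 0 \<in> measurable M rat_paths" by (rule restarted_measurable) simp
  obtain k where k: "mean_time_if_above (1 / real (Suc k)) \<noteq> 0"
    using pos unfolding SUP_mean_time_if_above[symmetric] by force
  define \<delta> where "\<delta> = 1 / real (Suc k)"
  have \<delta>: "0 < \<delta>" by (simp add: \<delta>_def)
  obtain q where q: "q \<in> rat_times" "emeasure M {\<omega>\<in>space M. \<delta> < X q \<omega> - X 0 \<omega>} \<noteq> 0"
  proof (rule ccontr)
    assume "\<not> thesis"
    with that have null: "emeasure M {\<omega>\<in>space M. \<delta> < X q \<omega> - X 0 \<omega>} = 0" if "q \<in> rat_times" for q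
      using that by blast
    have "AE \<omega> in M. \<forall>q\<in>rat_times. \<not> \<delta> < X q \<omega> - X 0 \<omega>"
    proof (intro AE_ball_countable' countable_rat_times)
      fix q assume q: "q \<in> rat_times"
      have [measurable]: "X q \<in> borel_measurable M" "X 0 \<in> borel_measurable M"
        using rat_times_nonneg[OF q] by (auto intro: random_variable_X)
      show "AE \<omega> in M. \<not> \<delta> < X q \<omega> - X 0 \<omega>"
        using null[OF q] by (intro AE_I[of _ _ "{\<omega>\<in>space M. \<delta> < X q \<omega> - X 0 \<omega>}"]) auto
    qed
    then have "AE \<omega> in M. last_overtaken rat_times (restarted 0 \<omega>) * indicator (rises_above \<delta>) (restarted 0 \<omega>) = 0"
      by eventually_elim (auto simp: rises_above_def restarted_def indicator_def)
    then have "mean_time_if_above \<delta> = (\<integral>\<^sup>+\<omega>. 0 \<partial>M)"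
      unfolding mean_time_if_above_def by (rule nn_integral_cong_AE)
    then show False using k by (simp add: \<delta>_def)
  qed
  have q0: "0 \<le> q" using rat_times_nonneg[OF q(1)] .
  obtain n0 :: nat where "y / \<delta> < real n0" using reals_Archimedean2 by blast
  define n where "n = Suc n0"
  have n: "y < real n * \<delta>"
    using \<open>y / \<delta> < real n0\<close> \<delta> by (simp add: n_def field_simps)
  define D where "D i \<omega> = X (real (Suc i) * q) \<omega> - X (real i * q) \<omega>" for i \<omega>
  have mono: "mono (\<lambda>i. real i * q)" using q0 by (auto simp: mono_def intro: mult_right_mono)
  have ind: "indep_vars (\<lambda>_. borel) D {..<n}"
    using indep_increments[OF mono, of n] by (simp add: D_def[abs_def])
  have Xm[measurable]: "X q \<in> borel_measurable M" "X 0 \<in> borel_measurable M"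
    "X (real i * q) \<in> borel_measurable M" for i
    using q0 by (auto intro!: random_variable_X)
  have Dm[measurable]: "D i \<in> borel_measurable M" for i
    using Xm(3)[of i] Xm(3)[of "Suc i"] unfolding D_def[abs_def]
      by (rule borel_measurable_diff[rotated])
  have law: "prob (D i -` {\<delta><..} \<inter> space M) = prob {\<omega>\<in>space M. \<delta> < X q \<omega> - X 0 \<omega>}" for i
  proof -
    have "distr M borel (D i) = distr M borel (X q)"
      using stationary_increments[of "real i * q" q] q0 by (simp add: D_def[abs_def] algebra_simps)
    then have "measure (distr M borel (D i)) {\<delta><..} = measure (distr M borel (X q)) {\<delta><..}" by simp
    then have "prob (D i -` {\<delta><..} \<inter> space M) = prob (X q -` {\<delta><..} \<inter> space M)"
      by (simp add: measure_distr)
    also have "\<dots> = prob {\<omega>\<in>space M. \<delta> < X q \<omega> - X 0 \<omega>}"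
      using start_zero by (intro measure_eq_AE) auto
    finally show ?thesis .
  qed
  have p: "0 < prob {\<omega>\<in>space M. \<delta> < X q \<omega> - X 0 \<omega>}"
    using q(2) by (simp add: emeasure_eq_measure less_le)
  have "prob (\<Inter>i\<in>{..<n}. D i -` {\<delta><..} \<inter> space M) = (\<Prod>i\<in>{..<n}. prob (D i -` {\<delta><..} \<inter> space M))"
    by (rule indep_varsD_finite[OF ind]) (auto simp: n_def)
  also have "\<dots> > 0" unfolding law using p by (intro prod_pos) auto
  finally have "0 < prob (\<Inter>i\<in>{..<n}. D i -` {\<delta><..} \<inter> space M)" .
  also have "\<dots> \<le> prob {\<omega>\<in>space M. restarted 0 \<omega> \<in> rises_above y}"
  proof (rule finite_measure_mono)
    show "(\<Inter>i\<in>{..<n}. D i -` {\<delta><..} \<inter> space M) \<subseteq> {\<omega>\<in>space M. restarted 0 \<omega> \<in> rises_above y}"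
    proof
      fix \<omega> assume \<omega>: "\<omega> \<in> (\<Inter>i\<in>{..<n}. D i -` {\<delta><..} \<inter> space M)"
      have "\<omega> \<in> space M" using INT_D[OF \<omega>, of 0] by (simp add: n_def)
      have "real n * \<delta> = (\<Sum>i<n. \<delta>)" by simp
      also have "\<dots> \<le> (\<Sum>i<n. D i \<omega>)" using INT_D[OF \<omega>] by (intro sum_mono) (auto intro: less_imp_le)
      also have "\<dots> = X (real n * q) \<omega> - X 0 \<omega>"
        unfolding D_def by (subst sum_lessThan_telescope) simp
      finally have "y < X (real n * q) \<omega> - X 0 \<omega>" using n by simp
      moreover have "real n * q \<in> rat_times" using q(1) by (auto simp: rat_times_def)
      ultimately show "\<omega> \<in> {\<omega>\<in>space M. restarted 0 \<omega> \<in> rises_above y}"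
        using \<open>\<omega> \<in> space M\<close> by (auto simp: rises_above_def restarted_def)
    qed
  qed (rule rises_above_event)
  finally show ?thesis by (simp add: emeasure_eq_measure)
qed

lemma mean_time_if_above_infinite:
  assumes inf: "(\<integral>\<^sup>+\<omega>. time_of_sup X \<omega> \<partial>M) = \<infinity>"
  shows "mean_time_if_above y = \<infinity>"
proof -
  let ?p = "emeasure M {\<omega>\<in>space M. restarted 0 \<omega> \<in> rises_above y}"
  have "\<infinity> = ?p * (SUP k. mean_time_if_above (1 / real (Suc k)))"
    using rises_above_positive[of y] inf unfolding SUP_mean_time_if_above
      by (simp add: ennreal_mult_top)
  also have "\<dots> = (SUP k. ?p * mean_time_if_above (1 / real (Suc k)))"
    by (rule SUP_mult_left_ennreal)
  also have "\<dots> \<le> mean_time_if_above y"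
    by (intro SUP_least mean_time_if_above_recursion) simp
  finally show ?thesis by (simp add: top_unique)
qed

section \<open>The distance to a stopping time\<close>

lemma expected_distance_infinite:
  assumes inf: "(\<integral>\<^sup>+\<omega>. time_of_sup X \<omega> \<partial>M) = \<infinity>"
    and \<tau>: "stopping_time (enlarged_filtration M X) \<tau>"
  shows "expected_distance M (time_of_sup X) \<tau> = \<infinity>"
proof -
  interpret N: prob_space "completion M" by (rule prob_space_completion)
  let ?dist = "\<lambda>\<omega>. e2ennreal \<bar>enn2ereal (time_of_sup X \<omega>) - enn2ereal (\<tau> \<omega>)\<bar>"
  define A where "A n = {\<omega>\<in>space M. \<tau> \<omega> \<le> ennreal (real n)}" for n
  have A_F: "A n \<in> sets (completed_filtration M X (ennreal (real (Suc n))))" for n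
  proof -
    have "A n \<in> sets (enlarged_filtration M X (ennreal (real n)))"
      using stopping_timeD[OF \<tau>, of "ennreal (real n)"] unfolding A_def pred_def by simp
    moreover have "ennreal (real n) < ennreal (real (Suc n))" by (intro ennreal_lessI) auto
    ultimately show ?thesis unfolding sets_enlarged_filtration by auto
  qed
  show ?thesis
  proof (cases "\<forall>n. emeasure (completion M) (A n) = 0")
    case True
    have A_N: "A n \<in> sets (completion M)" for n
      using completed_filtration_completion[OF _ A_F[of n]] by auto
    have "AE \<omega> in completion M. \<forall>n. \<omega> \<notin> A n"
      unfolding AE_all_countable using True A_N by (intro allI AE_not_in) (auto simp: null_sets_def)
    then have "AE \<omega> in M. ?dist \<omega> = \<infinity>"
      unfolding AE_completion_iff using AE_space
    proof eventually_elim
      case (elim \<omega>)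
      then have "\<tau> \<omega> = \<infinity>"
      proof (cases "\<tau> \<omega>")
        case (real r)
        obtain n where "r \<le> real n" using real_arch_simple by blast
        then have "\<omega> \<in> A n" using real elim by (auto simp: A_def intro: ennreal_leI)
        with elim show ?thesis by blast
      qed simp
      then show ?case
        by (cases "time_of_sup X \<omega>") auto
    qed
    then have "(\<integral>\<^sup>+\<omega>. ?dist \<omega> \<partial>M) = (\<integral>\<^sup>+\<omega>. \<infinity> \<partial>M)" by (rule nn_integral_cong_AE)
    then show ?thesis unfolding expected_distance_def by (simp add: emeasure_space_1)
  next
    case False
    then obtain n where n: "emeasure (completion M) (A n) \<noteq> 0" by auto
    \<comment> \<open>\<open>{\<tau> \<le> n}\<close> is only known to be in the past of every time after \<open>n\<close>, so the restart is at \<open>n + 1\<close>.\<close>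
    define s where "s = real (Suc n)"
    have s: "s \<in> rat_times" "0 \<le> s" by (auto simp: s_def rat_times_def)
    define C where "C k = A n \<inter> {\<omega>\<in>space M. \<forall>u\<in>{u\<in>rat_times. u \<le> s}. X u \<omega> \<le> X s \<omega> + real k}" for k
    have C_F: "C k \<in> sets (completed_filtration M X (ennreal s))" for k
      unfolding C_def using near_maximum_event[OF s(1)] A_F[of n] by (auto simp: s_def)
    have C_N: "C k \<in> sets (completion M)" for k
      using completed_filtration_completion[OF s(2) C_F] .
    \<comment> \<open>Almost every path is bounded on \<open>[0, s]\<close>, so the events \<open>C k\<close> exhaust \<open>A n\<close> up to a null set.\<close>
    obtain k where k: "emeasure (completion M) (C k) \<noteq> 0"
    proof (rule ccontr)
      assume "\<not> thesis"
      with that have null: "emeasure (completion M) (C k) = 0" for k by blast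
      have "AE \<omega> in completion M. \<forall>k. \<omega> \<notin> C k"
        unfolding AE_all_countable
          using null C_N by (intro allI AE_not_in) (auto simp: null_sets_def)
      then have "AE \<omega> in completion M. \<omega> \<notin> A n"
        unfolding AE_completion_iff using cadlag_paths
      proof eventually_elim
        case (elim \<omega>)
        obtain c where c: "\<forall>u\<in>{0..s}. X u \<omega> \<le> c"
          using cadlag_bounded_above[OF elim(2), of s] by blast
        obtain k :: nat where "c - X s \<omega> < real k" using reals_Archimedean2 by blast
        then have "X u \<omega> \<le> X s \<omega> + real k" if "u \<in> rat_times" "u \<le> s" for u
          using bspec[OF c, of u] that rat_times_nonneg[of u] by auto
        then show ?case using elim(1) by (auto simp: C_def A_def)
      qed
      moreover have "A n \<in> sets (completion M)"
        using completed_filtration_completion[OF _ A_F[of n]] by auto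
      ultimately have "emeasure (completion M) (A n) = 0"
        by (subst (asm) AE_iff_measurable[of "A n"])
          (auto simp: A_def simp del: emeasure_completion)
      with n show False by simp
    qed
    have "AE \<omega> in M. \<omega> \<in> C k \<longrightarrow> (\<forall>u. 0 \<le> u \<longrightarrow> u \<le> s \<longrightarrow> X u \<omega> \<le> X s \<omega> + real k)"
      using near_maximum_AE[OF s(1), of "real k"] by eventually_elim (auto simp: C_def)
    then have "emeasure (completion M) (C k) * mean_time_if_above (real k) \<le>
        (\<integral>\<^sup>+\<omega>. indicator (C k) \<omega> * (time_of_sup X \<omega> - ennreal s) \<partial>M)"
      by (rule mean_time_if_above_le_remaining_time[OF s(2) C_F])
    also have "\<dots> \<le> (\<integral>\<^sup>+\<omega>. ?dist \<omega> \<partial>M)"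
    proof (rule nn_integral_mono)
      fix \<omega>
      have "time_of_sup X \<omega> - ennreal s \<le> ?dist \<omega>" if "\<tau> \<omega> \<le> ennreal s"
      proof -
        have abs_ge: "x \<le> \<bar>x\<bar>" for x :: ereal by (cases x) auto
        have "time_of_sup X \<omega> - ennreal s \<le> time_of_sup X \<omega> - \<tau> \<omega>"
          using that by (rule ennreal_minus_mono[OF order_refl])
        also have "\<dots> = e2ennreal (enn2ereal (time_of_sup X \<omega> - \<tau> \<omega>))" by simp
        also have "\<dots> \<le> ?dist \<omega>"
          unfolding minus_ennreal.rep_eq by (intro e2ennreal_mono) (simp add: abs_ge)
        finally show ?thesis .
      qed
      moreover have "\<tau> \<omega> \<le> ennreal s" if "\<omega> \<in> C k"
        using that by (auto simp: C_def A_def s_def intro: order_trans ennreal_leI)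
      ultimately show "indicator (C k) \<omega> * (time_of_sup X \<omega> - ennreal s) \<le> ?dist \<omega>"
        by (auto simp: indicator_def)
    qed
    finally have "emeasure (completion M) (C k) * mean_time_if_above (real k) \<le> (\<integral>\<^sup>+\<omega>. ?dist \<omega> \<partial>M)" .
    then show ?thesis
      unfolding expected_distance_def mean_time_if_above_infinite[OF inf] using k
      by (simp add: ennreal_mult_top top_unique del: emeasure_completion)
  qed
qed

end

theorem proposition17:
  fixes M :: "'a measure" and X :: "real \<Rightarrow> 'a \<Rightarrow> real"
  assumes "levy_process M X"
    and "\<not> compound_poisson_process M X"
    and "drifts_to_minus_infinity M X"
    and "(\<integral>\<^sup>+ \<omega>. time_of_sup X \<omega> \<partial>M) = \<infinity>"
  shows "\<forall>\<tau> :: 'a \<Rightarrow> ennreal. stopping_time (enlarged_filtration M X) \<tau> \<longrightarrow>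
           expected_distance M (time_of_sup X) \<tau> = \<infinity>"
  using levy_process.expected_distance_infinite[OF assms(1,4)] by blast

end
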